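(* Let $F$ be a field and let $m = 2m'$, $n = 2n'$ be arbitrary positive even integers (with $m', n'$ positive integers). Then there exists a unital associative $F$-algebra $A$ such that the following two conditions are satisfied: (i) for all $u_1, u_2, \dots, u_{m+n-1} \in A$ we have $[u_1, u_2, \dots, u_{m+n-1}] = 0$, that is, the algebra $A$ is Lie nilpotent of class at most $m+n-2$; (ii) there are $v_1, \dots, v_m, w_1, \dots, w_n \in A$ such that $$[v_1, \dots, v_m]\,[w_1, \dots, w_n] \ne 0.$$
   Context: Left-normed commutators in an associative algebra are defined recursively by $[a_1,a_2] = a_1a_2 - a_2a_1$ and $[a_1,\dots,a_{\ell-1},a_\ell] = [[a_1,\dots,a_{\ell-1}],a_\ell]$ for $\ell \ge 3$. An associative algebra $A$ is Lie nilpotent of class at most $c$ if $[u_1,\dots,u_c,u_{c+1}] = 0$ for all $u_i \in A$. The field $F$ has arbitrary characteristic. *)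

theory Defs
  imports "HOL-Algebra.Algebra"
begin

(* The library locale algebra is not used here because it requires M to be commutative.
   Associativity and the unit of A come from the locale ring. *)
locale unital_assoc_algebra = module F A + ring A for F (structure) and A (structure) +
  assumes smult_mult_left:
      "\<lbrakk>a \<in> carrier F; x \<in> carrier A; y \<in> carrier A\<rbrakk> \<Longrightarrow>
        (a \<odot>\<^bsub>A\<^esub> x) \<otimes>\<^bsub>A\<^esub> y = a \<odot>\<^bsub>A\<^esub> (x \<otimes>\<^bsub>A\<^esub> y)"
    and smult_mult_right:
      "\<lbrakk>a \<in> carrier F; x \<in> carrier A; y \<in> carrier A\<rbrakk> \<Longrightarrow>
        x \<otimes>\<^bsub>A\<^esub> (a \<odot>\<^bsub>A\<^esub> y) = a \<odot>\<^bsub>A\<^esub> (x \<otimes>\<^bsub>A\<^esub> y)"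

definition commutator :: "('a, 'r) ring_scheme \<Rightarrow> 'a \<Rightarrow> 'a \<Rightarrow> 'a" where
  "commutator R x y = x \<otimes>\<^bsub>R\<^esub> y \<ominus>\<^bsub>R\<^esub> y \<otimes>\<^bsub>R\<^esub> x"

(* The list [a_1, ..., a_l] stands for the left-normed commutator of its entries; only
   l >= 2 is meaningful. The recursion on the last entry is left_normed_commutator_snoc. *)
definition left_normed_commutator :: "('a, 'r) ring_scheme \<Rightarrow> 'a list \<Rightarrow> 'a" where
  "left_normed_commutator R as = foldl (commutator R) (hd as) (tl as)"

lemma left_normed_commutator_two:
  "left_normed_commutator R [a, b] = a \<otimes>\<^bsub>R\<^esub> b \<ominus>\<^bsub>R\<^esub> b \<otimes>\<^bsub>R\<^esub> a"
  by (simp add: left_normed_commutator_def commutator_def)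

lemma left_normed_commutator_snoc:
  assumes "as \<noteq> []"
  shows "left_normed_commutator R (as @ [b]) = commutator R (left_normed_commutator R as) b"
  using assms by (simp add: left_normed_commutator_def)

definition lie_nilpotent_class_at_most :: "('a, 'r) ring_scheme \<Rightarrow> nat \<Rightarrow> bool" where
  "lie_nilpotent_class_at_most R c \<longleftrightarrow>
    (\<forall>us. set us \<subseteq> carrier R \<and> length us = c + 1 \<longrightarrow> left_normed_commutator R us = \<zero>\<^bsub>R\<^esub>)"

end

(* A is spanned over F by elements r e_S, where S runs over finite sets of indices, r over the
   even part R of an exterior algebra, and e_S e_T = sigma(S,T) e_(S Un T) if S and T are disjoint,
   0 otherwise. The cocycle sigma is chosen such that e_S and e_T commute up to the factor
   (1 + theta(S) theta(T)) (1 + eta(S) eta(T)), where theta(S) and eta(S) are the sums over i in S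
   of generators theta_i and eta_i, with theta_i present for all i but eta_i only for i < c = m + n - 4.
   Hence the left-normed commutator of e_(S_1), ..., e_(S_l) is, up to a unit, e_(S_1 Un ... Un S_l)
   times the product of the factors
   theta(T_k) theta(T_(k+1)) + eta(T_k) eta(T_(k+1)) + theta(T_k) theta(T_(k+1)) eta(T_k) eta(T_(k+1))
   with T_k = S_1 Un ... Un S_k. As theta(T)^2 = eta(T)^2 = 0, only the two alternating products
   theta theta eta eta theta theta ... and eta eta theta theta eta eta ... survive. For odd l both have
   degree l - 1 in the eta_i, which exceeds c for l = m + n - 1; for even l the first one has degree
   only l - 2, so that a product of commutators of lengths m and n reaches exactly degree c.
   Everything is defined over the integers and then extended to F, so that the characteristic of F
   plays no role. *)
theory Submission
  imports Defs
begin

section \<open>The even part of an exterior algebra over the integers\<close>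

definition twist :: "(nat \<Rightarrow> nat \<Rightarrow> 'a::comm_monoid_mult) \<Rightarrow> nat set \<Rightarrow> nat set \<Rightarrow> 'a" where
  "twist s S T = (\<Prod>i\<in>S. \<Prod>j\<in>T. s i j)"

lemma twist_empty [simp]: "twist s {} T = 1" "twist s S {} = 1"
  by (simp_all add: twist_def)

lemma twist_Un_left:
  "finite S \<Longrightarrow> finite S' \<Longrightarrow> S \<inter> S' = {} \<Longrightarrow> twist s (S \<union> S') T = twist s S T * twist s S' T"
  by (simp add: twist_def prod.union_disjoint)

lemma twist_Un_right:
  "finite T \<Longrightarrow> finite T' \<Longrightarrow> T \<inter> T' = {} \<Longrightarrow> twist s S (T \<union> T') = twist s S T * twist s S T'"
  by (simp add: twist_def prod.union_disjoint prod.distrib)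

text \<open>By multiplicativity over disjoint unions, both sides are the product of the values on
  (S, T), (S, V) and (T, V). This gives associativity twice: of the exterior algebra via
  \<open>order_sign\<close>, of the twisted algebra via \<open>sigma\<close>.\<close>

lemma twist_cocycle:
  assumes "finite S" "finite T" "finite V" "S \<inter> T = {}" "(S \<union> T) \<inter> V = {}"
  shows "twist s S T * twist s (S \<union> T) V = twist s T V * twist s S (T \<union> V)"
proof -
  have "T \<inter> V = {}" using assms by blast
  with assms show ?thesis by (simp add: twist_Un_left twist_Un_right ac_simps)
qed

text \<open>The sign of sorting the increasing list of S followed by that of T: pairs with j < i are
  the inversions.\<close>

abbreviation order_sign :: "nat set \<Rightarrow> nat set \<Rightarrow> int" where
  "order_sign \<equiv> twist (\<lambda>i j. if j < i then - 1 else 1)"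

lemma order_sign_square [simp]: "order_sign S T * order_sign S T = 1"
proof -
  have "order_sign S T * order_sign S T
      = (\<Prod>i\<in>S. \<Prod>j\<in>T. (if j < i then - 1 else 1) * (if j < i then - 1 else 1 :: int))"
    by (simp only: twist_def prod.distrib)
  also have "\<dots> = (\<Prod>i\<in>S. \<Prod>j\<in>T. 1)"
    by (intro prod.cong refl) auto
  finally show ?thesis by simp
qed

lemma order_sign_cases: "order_sign S T = 1 \<or> order_sign S T = - 1"
  using order_sign_square[of S T] by (metis square_eq_1_iff)

text \<open>Each pair from disjoint S and T is an inversion in exactly one of the two orders, so the
  two signs multiply to (-1)^(|S||T|).\<close>

lemma order_sign_commute:
  assumes "S \<inter> T = {}" "even (card S) \<or> even (card T)"
  shows "order_sign S T = order_sign T S"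
proof -
  have "order_sign T S = (\<Prod>i\<in>S. \<Prod>j\<in>T. if i < j then - 1 else 1)"
    unfolding twist_def by (rule prod.swap)
  hence "order_sign S T * order_sign T S
      = (\<Prod>i\<in>S. \<Prod>j\<in>T. (if j < i then - 1 else 1) * (if i < j then - 1 else 1 :: int))"
    by (simp only: twist_def prod.distrib)
  also have "\<dots> = (\<Prod>i\<in>S. \<Prod>j\<in>T. - 1)"
    using assms(1) by (intro prod.cong refl) auto
  also have "\<dots> = 1"
    using assms(2) by (auto simp flip: power_mult)
  finally show ?thesis
    using order_sign_cases[of S T] order_sign_cases[of T S] by auto
qed

text \<open>An element is the family of its coefficients at the monomials. Infinite support is
  harmless, since a coefficient of a product at a finite set only involves its finitely many
  subsets. Even degree makes the ring commutative.\<close>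

typedef even_ext = "{f :: nat set \<Rightarrow> int. \<forall>S. f S \<noteq> 0 \<longrightarrow> finite S \<and> even (card S)}"
  morphisms ecoeff Abs_even_ext
  by (rule exI[of _ "\<lambda>_. 0"]) simp

setup_lifting type_definition_even_ext

lemma even_ext_eqI: "(\<And>S. ecoeff x S = ecoeff y S) \<Longrightarrow> x = y"
  by (simp add: ecoeff_inject[symmetric] fun_eq_iff)

lemma ecoeff_nonzeroD: "ecoeff x S \<noteq> 0 \<Longrightarrow> finite S" "ecoeff x S \<noteq> 0 \<Longrightarrow> even (card S)"
  using ecoeff[of x] by auto

lemma ecoeff_infinite: "infinite S \<Longrightarrow> ecoeff x S = 0"
  using ecoeff_nonzeroD(1) by blast

text \<open>The ordered product of the generators indexed by \<open>I\<close>, with junk value \<open>0\<close> if \<open>I\<close> is infinite or of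
  odd size.\<close>

lift_definition emon :: "nat set \<Rightarrow> even_ext" is
  "\<lambda>I K. if K = I \<and> finite I \<and> even (card I) then 1 else 0" by auto

instantiation even_ext :: comm_ring_1
begin

lift_definition zero_even_ext :: even_ext is "\<lambda>_. 0" by simp
definition one_even_ext :: even_ext where "1 = emon {}"
lift_definition plus_even_ext :: "even_ext \<Rightarrow> even_ext \<Rightarrow> even_ext" is "\<lambda>f g S. f S + g S"
  by (metis add_0)
lift_definition minus_even_ext :: "even_ext \<Rightarrow> even_ext \<Rightarrow> even_ext" is "\<lambda>f g S. f S - g S"
  by (metis diff_0_right)
lift_definition uminus_even_ext :: "even_ext \<Rightarrow> even_ext" is "\<lambda>f S. - f S"
  by simp
lift_definition times_even_ext :: "even_ext \<Rightarrow> even_ext \<Rightarrow> even_ext" is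
  "\<lambda>f g U. \<Sum>S\<in>Pow U. order_sign S (U - S) * f S * g (U - S)"
proof -
  fix f g :: "nat set \<Rightarrow> int" and U
  assume f: "\<And>S. f S \<noteq> 0 \<Longrightarrow> finite S \<and> even (card S)"
    and g: "\<And>S. g S \<noteq> 0 \<Longrightarrow> finite S \<and> even (card S)"
    and nz: "(\<Sum>S\<in>Pow U. order_sign S (U - S) * f S * g (U - S)) \<noteq> 0"
  from nz obtain S where "S \<in> Pow U" "order_sign S (U - S) * f S * g (U - S) \<noteq> 0"
    by (rule sum.not_neutral_contains_not_neutral)
  then have S: "S \<subseteq> U" "f S \<noteq> 0" "g (U - S) \<noteq> 0"
    by simp_all
  have "finite (S \<union> (U - S)) \<and> even (card (S \<union> (U - S)))"
    using f[OF S(2)] g[OF S(3)] by (simp add: card_Un_disjoint del: Un_Diff_cancel)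
  moreover have "S \<union> (U - S) = U" using S(1) by blast
  ultimately show "finite U \<and> even (card U)" by (simp only:)
qed

lemma ecoeff_simps [simp]:
  "ecoeff 0 S = 0" "ecoeff (x + y) S = ecoeff x S + ecoeff y S"
  "ecoeff (x - y) S = ecoeff x S - ecoeff y S" "ecoeff (- x) S = - ecoeff x S"
  by (transfer; simp)+

lemma ecoeff_mult:
  "ecoeff (x * y) U = (\<Sum>S\<in>Pow U. order_sign S (U - S) * ecoeff x S * ecoeff y (U - S))"
  by (simp add: times_even_ext.rep_eq)

lemma ecoeff_emon: "ecoeff (emon I) K = (if K = I \<and> finite I \<and> even (card I) then 1 else 0)"
  by (simp add: emon.rep_eq)

lemma ecoeff_one: "ecoeff 1 K = (if K = {} then 1 else 0)"
  by (simp add: one_even_ext_def ecoeff_emon)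

instance
proof
  fix x y z :: even_ext
  show "x * y * z = x * (y * z)"
  proof (rule even_ext_eqI)
    fix U
    show "ecoeff (x * y * z) U = ecoeff (x * (y * z)) U"
    proof (cases "finite U")
      case fin: True
      let ?L = "\<lambda>(S, T). order_sign S (U - S) * order_sign T (S - T) * ecoeff x T * ecoeff y (S - T) * ecoeff z (U - S)"
      let ?R = "\<lambda>(T, V). order_sign T (U - T) * order_sign V (U - T - V) * ecoeff x T * ecoeff y V * ecoeff z (U - T - V)"
      have finS: "finite S" if "S \<in> Pow U" for S
        using that fin by (auto intro: finite_subset)
      have "ecoeff (x * y * z) U = (\<Sum>S\<in>Pow U. \<Sum>T\<in>Pow S. ?L (S, T))"
        by (simp add: ecoeff_mult sum_distrib_left sum_distrib_right ac_simps)
      also have "\<dots> = sum ?L (SIGMA S : Pow U. Pow S)"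
        using fin finS by (subst sum.Sigma) auto
      finally have "ecoeff (x * y * z) U = sum ?L (SIGMA S : Pow U. Pow S)" .
      also have "\<dots> = sum ?R (SIGMA T : Pow U. Pow (U - T))"
      \<comment> \<open>U is cut into the blocks T, S - T and U - S; the left side splits off U - S
        first, the right side T.\<close>
      proof (rule sum.reindex_bij_witness[of _ "\<lambda>(T, V). (T \<union> V, T)" "\<lambda>(S, T). (T, S - T)"])
        fix a assume "a \<in> (SIGMA S : Pow U. Pow S)"
        then obtain S T where a: "a = (S, T)" "S \<subseteq> U" "T \<subseteq> S" by auto
        have *: "U - T - (S - T) = U - S" "T \<union> (S - T) = S" "(S - T) \<union> (U - S) = U - T" using a by auto
        have "finite T" "finite S" using a fin by (auto intro: finite_subset)
        hence "order_sign T (S - T) * order_sign (T \<union> (S - T)) (U - S)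
            = order_sign (S - T) (U - S) * order_sign T ((S - T) \<union> (U - S))"
          using a fin by (intro twist_cocycle) auto
        thus "(case case a of (S, T) \<Rightarrow> (T, S - T) of (T, V) \<Rightarrow> order_sign T (U - T) * order_sign V (U - T - V) * ecoeff x T * ecoeff y V * ecoeff z (U - T - V)) = ?L a"
          unfolding a * by (simp add: * ac_simps)
      qed auto
      also have "\<dots> = (\<Sum>T\<in>Pow U. \<Sum>V\<in>Pow (U - T). ?R (T, V))"
        using fin by (subst sum.Sigma) auto
      also have "\<dots> = ecoeff (x * (y * z)) U"
        by (simp add: ecoeff_mult sum_distrib_left ac_simps)
      finally show ?thesis .
    next
      case False
      then show ?thesis by (simp add: ecoeff_infinite)
    qed
  qed
  show "x * y = y * x"
  proof (rule even_ext_eqI)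
    fix U
    show "ecoeff (x * y) U = ecoeff (y * x) U"
      unfolding ecoeff_mult
    proof (rule sum.reindex_bij_witness[of _ "\<lambda>S. U - S" "\<lambda>S. U - S"])
      fix S assume "S \<in> Pow U"
      then have "U - (U - S) = S" by blast
      moreover have "ecoeff x S \<noteq> 0 \<Longrightarrow> order_sign S (U - S) = order_sign (U - S) S"
        using ecoeff_nonzeroD(2)[of x S] by (intro order_sign_commute) auto
      ultimately show "order_sign (U - S) (U - (U - S)) * ecoeff y (U - S) * ecoeff x (U - (U - S))
          = order_sign S (U - S) * ecoeff x S * ecoeff y (U - S)"
        by (cases "ecoeff x S = 0") auto
    qed auto
  qed
  show "1 * x = x"
  proof (rule even_ext_eqI)
    fix U
    show "ecoeff (1 * x) U = ecoeff x U"
    proof (cases "finite U")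
      case True
      have "ecoeff (1 * x) U = (\<Sum>S\<in>{{}}. order_sign S (U - S) * ecoeff 1 S * ecoeff x (U - S))"
        unfolding ecoeff_mult using True by (intro sum.mono_neutral_right) (auto simp: ecoeff_one)
      then show ?thesis by (simp add: ecoeff_one)
    next
      case False
      then show ?thesis by (simp add: ecoeff_infinite)
    qed
  qed
  show "(x + y) * z = x * z + y * z"
    by (rule even_ext_eqI) (simp add: ecoeff_mult algebra_simps sum.distrib)
  show "(0::even_ext) \<noteq> 1"
    using ecoeff_one[of "{}"] ecoeff_simps(1)[of "{}"] by (metis zero_neq_one)
  show "x + y + z = x + (y + z)" by (rule even_ext_eqI) simp
  show "x + y = y + x" by (rule even_ext_eqI) simp
  show "0 + x = x" by (rule even_ext_eqI) simp
  show "- x + x = 0" by (rule even_ext_eqI) simp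
  show "x - y = x + - y" by (rule even_ext_eqI) simp
qed

end

text \<open>Integer coefficients have no 2-torsion. Since this is applied before passing to F, its
  consequences also hold in characteristic 2.\<close>

lemma even_ext_eq_uminus:
  fixes x :: even_ext
  assumes "x = - x"
  shows "x = 0"
proof (rule even_ext_eqI)
  fix S
  have "ecoeff x S = - ecoeff x S"
    by (subst assms) simp
  thus "ecoeff x S = ecoeff 0 S" by simp
qed

lemma ecoeff_of_int_mult: "ecoeff (of_int c * x) S = c * ecoeff x S"
proof -
  have "ecoeff (of_nat n * x) S = int n * ecoeff x S" for n
    by (induction n) (simp_all add: algebra_simps)
  then show ?thesis
    by (cases c rule: int_diff_cases) (simp add: left_diff_distrib)
qed

lemma ecoeff_emon_mult:
  assumes "finite I" "even (card I)"
  shows "ecoeff (emon I * x) U = (if I \<subseteq> U \<and> finite U then order_sign I (U - I) * ecoeff x (U - I) else 0)"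
proof (cases "finite U")
  case True
  have "ecoeff (emon I * x) U = (\<Sum>S\<in>Pow U. if S = I then order_sign I (U - I) * ecoeff x (U - I) else 0)"
    unfolding ecoeff_mult by (intro sum.cong) (use assms in \<open>auto simp: ecoeff_emon\<close>)
  also have "\<dots> = (if I \<subseteq> U then order_sign I (U - I) * ecoeff x (U - I) else 0)"
    using True by (simp add: sum.delta)
  finally show ?thesis using True by simp
next
  case False
  then show ?thesis by (simp add: ecoeff_infinite)
qed

lemma emon_mult:
  assumes "finite I" "finite J" "even (card I)" "even (card J)"
  shows "emon I * emon J = (if I \<inter> J = {} then of_int (order_sign I J) * emon (I \<union> J) else 0)"
proof (rule even_ext_eqI)
  fix U
  show "ecoeff (emon I * emon J) U
      = ecoeff (if I \<inter> J = {} then of_int (order_sign I J) * emon (I \<union> J) else 0) U"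
  proof (cases "I \<inter> J = {} \<and> U = I \<union> J")
    case True
    then have "U - I = J" "card U = card I + card J"
      using assms by (auto intro: card_Un_disjoint)
    then show ?thesis
      using assms True by (simp add: ecoeff_emon_mult ecoeff_of_int_mult ecoeff_emon)
  next
    case False
    then have "\<not> (I \<subseteq> U \<and> J = U - I)" by blast
    then show ?thesis
      using assms False by (auto simp: ecoeff_emon_mult ecoeff_of_int_mult ecoeff_emon)
  qed
qed

section \<open>Products of two odd generators\<close>

definition gen2 :: "nat \<Rightarrow> nat \<Rightarrow> even_ext" where
  "gen2 a b = (if a < b then emon {a, b} else if b < a then - emon {a, b} else 0)"

lemma gen2_swap: "gen2 b a = - gen2 a b"
  by (auto simp: gen2_def insert_commute)

lemma emon_eq_0: "infinite I \<or> odd (card I) \<Longrightarrow> emon I = 0"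
  by (rule even_ext_eqI) (auto simp: ecoeff_emon)

lemma emon_mult_gen2_eq_0:
  assumes "a = b \<or> a \<in> I \<or> b \<in> I"
  shows "emon I * gen2 a b = 0"
proof (cases "finite I \<and> even (card I)")
  case True
  then show ?thesis using assms by (auto simp: gen2_def emon_mult)
qed (use emon_eq_0 in auto)

lemma emon_mult_gen2:
  assumes "a \<noteq> b" "a \<notin> I" "b \<notin> I"
  shows "\<exists>d. \<bar>d\<bar> = 1 \<and> emon I * gen2 a b = of_int d * emon (insert a (insert b I))"
proof (cases "finite I \<and> even (card I)")
  case True
  then have "emon I * gen2 a b = of_int (order_sign I {a, b} * order_sign {a} {b}) * emon (insert a (insert b I))"
    using assms by (auto simp: gen2_def emon_mult twist_def)
  moreover have "\<bar>order_sign I {a, b} * order_sign {a} {b}\<bar> = 1"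
    using order_sign_cases[of I "{a, b}"] order_sign_cases[of "{a}" "{b}"] by (auto simp: abs_mult)
  ultimately show ?thesis by blast
next
  case False
  then have "infinite (insert a (insert b I)) \<or> odd (card (insert a (insert b I)))"
    using assms by auto
  then show ?thesis using False emon_eq_0 by (intro exI[of _ 1]) auto
qed

lemma gen2_mult:
  "gen2 a b * gen2 c d = (if distinct [a, b, c, d]
     then of_int (order_sign {a} {b} * order_sign {c} {d} * order_sign {a, b} {c, d}) * emon {a, b, c, d}
     else 0)"
proof (cases "a = b \<or> c = d")
  case False
  then have "card {a, b} = 2" "card {c, d} = 2" by auto
  then show ?thesis using False
    by (auto simp: gen2_def emon_mult twist_def insert_commute)
qed (auto simp: gen2_def)

text \<open>Two adjacent odd generators, the middle ones, are transposed. If an index repeats, both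
  sides are 0.\<close>

lemma gen2_exchange: "gen2 a b * gen2 c d = - (gen2 a c * gen2 b d)"
proof (cases "distinct [a, b, c, d]")
  case True
  moreover have "{a, b, c, d} = {a, c, b, d}" by auto
  ultimately show ?thesis
    by (auto simp: gen2_mult twist_def)
next
  case False
  then have "\<not> distinct [a, c, b, d]" by auto
  with False show ?thesis by (simp only: gen2_mult if_False minus_zero)
qed

section \<open>Skew forms and twisted products\<close>

text \<open>For f i j = x_i x_j with odd generators x_i this is x(S) x(T), where x(S) is the sum of
  the x_i over S.\<close>

definition bil :: "(nat \<Rightarrow> nat \<Rightarrow> even_ext) \<Rightarrow> nat set \<Rightarrow> nat set \<Rightarrow> even_ext" where
  "bil f S T = (\<Sum>i\<in>S. \<Sum>j\<in>T. f i j)"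

lemma bil_empty [simp]: "bil f {} T = 0" "bil f S {} = 0"
  by (simp_all add: bil_def)

lemma bil_Un_right:
  "finite T \<Longrightarrow> finite T' \<Longrightarrow> T \<inter> T' = {} \<Longrightarrow> bil f S (T \<union> T') = bil f S T + bil f S T'"
  by (simp add: bil_def sum.union_disjoint sum.distrib)

lemma bil_insert_left:
  "finite S \<Longrightarrow> i \<notin> S \<Longrightarrow> bil f (insert i S) T = bil f {i} T + bil f S T"
  by (simp add: bil_def)

lemma bil_insert_right:
  "finite T \<Longrightarrow> j \<notin> T \<Longrightarrow> bil f S (insert j T) = bil f S {j} + bil f S T"
  by (simp add: bil_def sum.distrib)

text \<open>The relations between the products of pairs of generators in an exterior algebra. Working with
  these even elements only keeps all coefficients commutative.\<close>

locale skew_form =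
  fixes f :: "nat \<Rightarrow> nat \<Rightarrow> even_ext"
  assumes skew: "f j i = - f i j"
    and exchange: "f i j * f k l = - (f i k * f j l)"
begin

lemma bil_swap: "bil f T S = - bil f S T"
proof -
  have "bil f T S = (\<Sum>i\<in>T. \<Sum>j\<in>S. - f j i)"
    unfolding bil_def by (intro sum.cong refl skew)
  also have "\<dots> = - bil f S T"
    unfolding bil_def by (subst sum.swap) (simp add: sum_negf)
  finally show ?thesis .
qed

lemma bil_self: "bil f S S = 0"
  by (rule even_ext_eq_uminus) (rule bil_swap)

text \<open>This is x(S) x(T) x(T) x(U) = 0: \<open>exchange\<close> swaps j and k, which both run
  over T, so the product is its own negative.\<close>

lemma bil_mult_bil: "bil f S T * bil f T U = 0"
proof (rule even_ext_eq_uminus)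
  have "bil f S T * bil f T U = (\<Sum>i\<in>S. \<Sum>j\<in>T. \<Sum>k\<in>T. \<Sum>l\<in>U. f i j * f k l)"
    by (simp only: bil_def sum_distrib_right) (simp only: sum_distrib_left)
  also have "\<dots> = (\<Sum>i\<in>S. \<Sum>j\<in>T. \<Sum>k\<in>T. \<Sum>l\<in>U. - (f i k * f j l))"
    by (intro sum.cong refl exchange)
  also have "\<dots> = (\<Sum>i\<in>S. \<Sum>k\<in>T. \<Sum>j\<in>T. \<Sum>l\<in>U. - (f i k * f j l))"
    by (intro sum.cong refl sum.swap)
  also have "\<dots> = - (bil f S T * bil f T U)"
    by (simp only: bil_def sum_distrib_right sum_negf) (simp only: sum_distrib_left)
  finally show "bil f S T * bil f T U = - (bil f S T * bil f T U)" .
qed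

text \<open>As x(S)^2 = 0, the first factor is also x(S) x(S \<union> T), ending with the sum with
  which the second one begins. Hence two consecutive steps of a left-normed commutator cannot both
  use the same form.\<close>

lemma bil_mult_bil_Un:
  assumes "finite S" "finite T" "S \<inter> T = {}"
  shows "bil f S T * bil f (S \<union> T) V = 0"
proof -
  have "bil f S T = bil f S (S \<union> T)"
    using assms by (simp add: bil_Un_right bil_self)
  then show ?thesis by (simp add: bil_mult_bil)
qed

text \<open>When the product is multiplied out one index at a time, every cross term contains the
  square of x_i or of x(T) and vanishes.\<close>

lemma prod_one_plus:
  assumes "finite S" "finite T"
  shows "(\<Prod>i\<in>S. \<Prod>j\<in>T. 1 + f i j) = 1 + bil f S T"
proof -
  have inner: "(\<Prod>j\<in>T. 1 + f i j) = 1 + bil f {i} T" for i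
    using assms(2)
  proof (induction T)
    case (insert j T)
    have "bil f {i} T * bil f {i} {j} = - (bil f T {i} * bil f {i} {j})"
      by (subst bil_swap) simp
    then have "f i j * bil f {i} T = 0"
      by (simp add: bil_mult_bil) (simp add: bil_def mult.commute)
    moreover have "bil f {i} {j} = f i j" by (simp add: bil_def)
    ultimately show ?case
      using insert by (simp add: bil_insert_right[OF insert(1,2)] algebra_simps)
  qed simp
  show ?thesis
    using assms(1)
  proof (induction S)
    case (insert i S)
    have "bil f {i} T * bil f S T = - (bil f {i} T * bil f T S)"
      by (subst (2) bil_swap) simp
    then have "bil f {i} T * bil f S T = 0"
      by (simp add: bil_mult_bil)
    then show ?case
      using insert by (simp add: inner bil_insert_left[OF insert(1,2)] algebra_simps)
  qed simp
qed

lemma inverse_one_plus: "(1 + f i j) * (1 + f j i) = 1"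
proof -
  have swap: "f j i = - f i j" by (rule skew)
  have "f i j * f j i = 0"
    using bil_mult_bil[of "{i}" "{j}" "{i}"] by (simp add: bil_def)
  then show ?thesis by (simp add: swap algebra_simps)
qed

end

section \<open>Constant terms and the degree filtration\<close>

lemma ecoeff_mult_empty: "ecoeff (x * y) {} = ecoeff x {} * ecoeff y {}"
  by (simp add: ecoeff_mult)

lemma ecoeff_prod_empty:
  "(\<And>i. i \<in> S \<Longrightarrow> ecoeff (h i) {} = 1) \<Longrightarrow> ecoeff (prod h S) {} = 1"
  by (induction S rule: infinite_finite_induct) (auto simp: ecoeff_mult_empty ecoeff_one)

text \<open>The filtration by degree in the generators with index in H, which later are the
  \<open>eta\<close> generators.\<close>

definition fil :: "nat set \<Rightarrow> nat \<Rightarrow> even_ext \<Rightarrow> bool" where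
  "fil H d x \<longleftrightarrow> (\<forall>I. ecoeff x I \<noteq> 0 \<longrightarrow> d \<le> card (I \<inter> H))"

lemma fil_trivial [simp]: "fil H 0 x" "fil H d 0"
  by (simp_all add: fil_def)

lemma fil_add:
  assumes "fil H d x" "fil H d y"
  shows "fil H d (x + y)"
  unfolding fil_def
proof (intro allI impI)
  fix I assume "ecoeff (x + y) I \<noteq> 0"
  then have "ecoeff x I \<noteq> 0 \<or> ecoeff y I \<noteq> 0" by auto
  then show "d \<le> card (I \<inter> H)" using assms unfolding fil_def by blast
qed

lemma fil_sum: "(\<And>i. i \<in> S \<Longrightarrow> fil H d (h i)) \<Longrightarrow> fil H d (sum h S)"
  by (induction S rule: infinite_finite_induct) (auto intro: fil_add)

lemma fil_mult:
  assumes "fil H d x" "fil H e y"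
  shows "fil H (d + e) (x * y)"
  unfolding fil_def
proof (intro allI impI)
  fix U assume nz: "ecoeff (x * y) U \<noteq> 0"
  then have fin: "finite U" by (rule ecoeff_nonzeroD)
  from nz obtain S where "S \<in> Pow U" "order_sign S (U - S) * ecoeff x S * ecoeff y (U - S) \<noteq> 0"
    unfolding ecoeff_mult by (rule sum.not_neutral_contains_not_neutral)
  then have S: "S \<subseteq> U" "d \<le> card (S \<inter> H)" "e \<le> card ((U - S) \<inter> H)"
    using assms by (auto simp: fil_def)
  have "card (S \<inter> H) + card ((U - S) \<inter> H) = card ((S \<inter> H) \<union> ((U - S) \<inter> H))"
    using fin finite_subset[OF S(1) fin] by (intro card_Un_disjoint[symmetric]) auto
  also have "(S \<inter> H) \<union> ((U - S) \<inter> H) = U \<inter> H" using S(1) by blast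
  finally show "d + e \<le> card (U \<inter> H)" using S by linarith
qed

lemma fil_mult_right: "fil H d x \<Longrightarrow> fil H d (x * y)"
  using fil_mult[of H d x 0 y] by simp

text \<open>A monomial contains each generator at most once, so its degree in H is at most the size
  of H. The nilpotency of the algebra rests on this bound.\<close>

lemma fil_eq_0:
  assumes "fil H d x" "card H < d" "finite H"
  shows "x = 0"
proof (rule even_ext_eqI, simp, rule ccontr)
  fix S assume "ecoeff x S \<noteq> 0"
  then have "d \<le> card (S \<inter> H)" using assms(1) by (auto simp: fil_def)
  also have "\<dots> \<le> card H" using assms(3) by (intro card_mono) auto
  finally show False using assms(2) by simp
qed

section \<open>The twisting cocycle and commutators of pairs\<close>

locale skew_pair = f: skew_form f + g: skew_form g for f g +
  fixes H :: "nat set"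
  assumes f_empty: "ecoeff (f i j) {} = 0"
    and g_fil: "fil H 2 (g i j)"
begin

text \<open>The commutation factor is attached only to pairs that are out of order, so that
  \<open>sigma S T\<close> and \<open>sigma T S\<close> differ by the factors of all pairs.\<close>

definition sigma :: "nat set \<Rightarrow> nat set \<Rightarrow> even_ext" where
  "sigma = twist (\<lambda>i j. if j < i then (1 + f i j) * (1 + g i j) else 1)"

lemma g_empty: "ecoeff (g i j) {} = 0"
  using g_fil[of i j] by (auto simp: fil_def)

lemma ecoeff_sigma_empty: "ecoeff (sigma S T) {} = 1"
  unfolding sigma_def twist_def
  by (intro ecoeff_prod_empty) (simp add: ecoeff_mult_empty ecoeff_one f_empty g_empty)

lemma sigma_commute:
  assumes "finite S" "finite T" "S \<inter> T = {}"
  shows "sigma S T = sigma T S * ((1 + bil f S T) * (1 + bil g S T))"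
proof -
  let ?s = "\<lambda>i j. if j < i then (1 + f i j) * (1 + g i j) else 1"
  \<comment> \<open>The factors for (i, j) and (j, i) are mutually inverse, so the relation holds
    whichever index is larger.\<close>
  have swap: "?s i j = ?s j i * ((1 + f i j) * (1 + g i j))" if "i \<noteq> j" for i j
  proof -
    have "((1 + f j i) * (1 + g j i)) * ((1 + f i j) * (1 + g i j))
        = ((1 + f j i) * (1 + f i j)) * ((1 + g j i) * (1 + g i j))"
      by (simp only: ac_simps)
    also have "\<dots> = 1"
      by (simp only: f.inverse_one_plus g.inverse_one_plus mult_1)
    finally show ?thesis
      using that by (cases "j < i") simp_all
  qed
  have "sigma S T = (\<Prod>i\<in>S. \<Prod>j\<in>T. ?s j i * ((1 + f i j) * (1 + g i j)))"
    unfolding sigma_def twist_def by (intro prod.cong refl swap) (use assms(3) in blast)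
  also have "\<dots> = (\<Prod>i\<in>S. \<Prod>j\<in>T. ?s j i) * ((1 + bil f S T) * (1 + bil g S T))"
    by (simp only: prod.distrib f.prod_one_plus[OF assms(1,2)] g.prod_one_plus[OF assms(1,2)])
  also have "(\<Prod>i\<in>S. \<Prod>j\<in>T. ?s j i) = sigma T S"
    unfolding sigma_def twist_def by (rule prod.swap)
  finally show ?thesis .
qed

text \<open>A pair \<open>(r, S)\<close> stands for the element \<open>r e_S\<close>.\<close>

fun pmult :: "even_ext \<times> nat set \<Rightarrow> even_ext \<times> nat set \<Rightarrow> even_ext \<times> nat set" where
  "pmult (r, S) (r', T) = (if S \<inter> T = {} then r * r' * sigma S T else 0, S \<union> T)"

text \<open>Pairs with different sets have no sum, but the two products of a couple of pairs carry
  the same set S \<union> T, so their difference is again a pair.\<close>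

fun pcomm :: "even_ext \<times> nat set \<Rightarrow> even_ext \<times> nat set \<Rightarrow> even_ext \<times> nat set" where
  "pcomm (r, S) (r', T) = (if S \<inter> T = {} then r * r' * (sigma S T - sigma T S) else 0, S \<union> T)"

text \<open>With \<open>sigma T S\<close> factored out, (1 + p)(1 + q) - 1 remains, where p and q
  are the values of the two forms.\<close>

lemma pcomm_disjoint:
  assumes "finite S" "finite T" "S \<inter> T = {}"
  shows "pcomm (r, S) (r', T)
    = (r * r' * sigma T S * (bil f S T + bil g S T + bil f S T * bil g S T), S \<union> T)"
  using assms(3) by (simp add: sigma_commute[OF assms] algebra_simps)

text \<open>The summands \<open>a\<close> and \<open>b\<close> are the alternating products whose last factor comes from \<open>f\<close> and \<open>g\<close>,
  respectively: two consecutive factors from the same form multiply to zero.\<close>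

definition alternating :: "nat \<Rightarrow> nat \<Rightarrow> even_ext \<Rightarrow> nat set \<Rightarrow> bool" where
  "alternating d e r S \<longleftrightarrow> (\<exists>a b. r = a + b \<and> fil H d a \<and> fil H e b \<and>
     (\<forall>V. a * bil f S V = 0) \<and> (\<forall>V. b * bil g S V = 0))"

lemma alternating_0 [simp]: "alternating d e 0 S"
  unfolding alternating_def by (intro exI[of _ 0]) simp

lemma fil_bil: "fil H 2 (bil g S T)"
  unfolding bil_def by (intro fil_sum g_fil)

lemma alternating_pcomm_init:
  assumes "finite S" "finite T" "pcomm (r, S) (r', T) = (r'', U)"
  shows "alternating 0 2 r'' U"
proof (cases "S \<inter> T = {}")
  case disj: True
  let ?c = "r * r' * sigma T S" and ?p = "bil f S T" and ?q = "bil g S T"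
  have U: "U = S \<union> T" and "r'' = ?c * (?p + ?q + ?p * ?q)"
    using assms(3) unfolding pcomm_disjoint[OF assms(1,2) disj] by simp_all
  \<comment> \<open>The mixed term joins the first summand, where its factor \<open>?p\<close> still
    annihilates every \<open>bil f U V\<close>.\<close>
  then have r'': "r'' = ?c * ?p * (1 + ?q) + ?c * ?q"
    by (simp add: algebra_simps)
  have "?c * ?p * (1 + ?q) * bil f U V = ?c * (1 + ?q) * (?p * bil f U V)" for V
    by (simp only: ac_simps)
  moreover have "?c * ?q * bil g U V = ?c * (?q * bil g U V)" for V
    by (simp only: ac_simps)
  moreover have "fil H 2 (?c * ?q)"
    by (subst mult.commute) (intro fil_mult_right fil_bil)
  ultimately show ?thesis
    unfolding alternating_def r''
    by (intro exI[of _ "?c * ?p * (1 + ?q)"] exI[of _ "?c * ?q"])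
      (simp add: U f.bil_mult_bil_Un g.bil_mult_bil_Un assms(1,2) disj)
next
  case False
  then show ?thesis using assms by simp
qed

text \<open>A new factor from f survives only on b, and one from g only on a. So the summands change
  roles: the new a inherits the bound e, and the new b gets d plus the degree 2 of g.\<close>

lemma alternating_pcomm:
  assumes "finite S" "finite T" "alternating d e r S" "pcomm (r, S) (r', T) = (r'', U)"
  shows "alternating e (d + 2) r'' U"
proof (cases "S \<inter> T = {}")
  case disj: True
  let ?c = "r' * sigma T S" and ?p = "bil f S T" and ?q = "bil g S T"
  obtain a b where ab: "r = a + b" "fil H d a" "fil H e b"
    "\<And>V. a * bil f S V = 0" "\<And>V. b * bil g S V = 0"
    using assms(3) by (auto simp: alternating_def)
  have U: "U = S \<union> T" and "r'' = (a + b) * r' * sigma T S * (?p + ?q + ?p * ?q)"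
    using assms(4) unfolding pcomm_disjoint[OF assms(1,2) disj] ab(1) by simp_all
  \<comment> \<open>The bracket collects the repeated factors \<open>a * ?p\<close> and
    \<open>b * ?q\<close> together with both mixed terms; all of it vanishes.\<close>
  moreover have "(a + b) * r' * sigma T S * (?p + ?q + ?p * ?q)
     = b * ?p * ?c + a * ?q * ?c + (a * ?p * (?c * (1 + ?q)) + b * ?q * (?c * (1 + ?p)))"
    by (simp add: algebra_simps)
  ultimately have r'': "r'' = b * ?p * ?c + a * ?q * ?c"
    by (simp only: ab mult_zero_left add_0_right)
  have "b * ?p * ?c * bil f U V = b * ?c * (?p * bil f U V)" for V
    by (simp only: ac_simps)
  moreover have "a * ?q * ?c * bil g U V = a * ?c * (?q * bil g U V)" for V
    by (simp only: ac_simps)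
  moreover have "fil H e (b * ?p * ?c)"
    by (intro fil_mult_right ab)
  moreover have "fil H (d + 2) (a * ?q * ?c)"
    by (rule fil_mult_right, rule fil_mult) (rule ab fil_bil)+
  ultimately show ?thesis
    unfolding alternating_def r''
    by (intro exI[of _ "b * ?p * ?c"] exI[of _ "a * ?q * ?c"])
      (simp add: U f.bil_mult_bil_Un g.bil_mult_bil_Un assms(1,2) disj)
next
  case False
  then show ?thesis using assms by simp
qed

text \<open>For pairwise disjoint sets this is the cocycle identity; otherwise both sides are 0 on
  the union of the three sets.\<close>

lemma pmult_assoc:
  assumes "finite (snd p)" "finite (snd q)" "finite (snd t)"
  shows "pmult (pmult p q) t = pmult p (pmult q t)"
proof -
  obtain r S where [simp]: "p = (r, S)" by (cases p)
  obtain r' T where [simp]: "q = (r', T)" by (cases q)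
  obtain r'' V where [simp]: "t = (r'', V)" by (cases t)
  have fin: "finite S" "finite T" "finite V" using assms by simp_all
  show ?thesis
  proof (cases "S \<inter> T = {} \<and> (S \<union> T) \<inter> V = {}")
    case True
    then have disj: "S \<inter> T = {}" "T \<inter> V = {}" "(S \<union> T) \<inter> V = {}" "S \<inter> (T \<union> V) = {}" by auto
    have "sigma S T * sigma (S \<union> T) V = sigma T V * sigma S (T \<union> V)"
      unfolding sigma_def using fin True by (intro twist_cocycle) auto
    then have "r * r' * sigma S T * r'' * sigma (S \<union> T) V = r * (r' * r'' * sigma T V) * sigma S (T \<union> V)"
      by (simp only: mult.assoc mult.left_commute[of _ r''])
    then show ?thesis using disj by (simp add: Un_assoc)
  next
    case False
    then have "\<not> (T \<inter> V = {} \<and> S \<inter> (T \<union> V) = {})" by auto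
    then show ?thesis using False by (auto simp: Un_assoc)
  qed
qed

lemma alternating_eq_0:
  assumes "alternating d e r S" "finite H" "card H < d" "card H < e"
  shows "r = 0"
proof -
  obtain a b where "r = a + b" "fil H d a" "fil H e b"
    using assms(1) unfolding alternating_def by blast
  then show ?thesis
    using fil_eq_0[of H d a] fil_eq_0[of H e b] assms(2-4) by simp
qed

lemma sigma_empty [simp]: "sigma {} T = 1" "sigma S {} = 1"
  by (simp_all add: sigma_def)

lemma pmult_one: "pmult (1, {}) p = p" "pmult p (1, {}) = p"
  by (cases p; simp)+

lemma finite_pmult: "finite (snd p) \<Longrightarrow> finite (snd q) \<Longrightarrow> finite (snd (pmult p q))"
  by (cases p; cases q) simp

lemma finite_pcomm: "finite (snd p) \<Longrightarrow> finite (snd q) \<Longrightarrow> finite (snd (pcomm p q))"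
  by (cases p; cases q) simp

end

section \<open>Nonvanishing of products of commutators\<close>

text \<open>The exterior generator with number i < c is eta_i, and the one with number c + i is
  theta_i, so the two families do not overlap.\<close>

definition theta :: "nat \<Rightarrow> nat \<Rightarrow> nat \<Rightarrow> even_ext" where
  "theta c i j = gen2 (c + i) (c + j)"

definition eta :: "nat \<Rightarrow> nat \<Rightarrow> nat \<Rightarrow> even_ext" where
  "eta c i j = (if i < c \<and> j < c then gen2 i j else 0)"

lemma ecoeff_gen2_nonzero: "ecoeff (gen2 a b) I \<noteq> 0 \<Longrightarrow> I = {a, b} \<and> a \<noteq> b"
  by (auto simp: gen2_def ecoeff_emon split: if_splits)

interpretation tw: skew_pair "theta c" "eta c" "{..<c}" for c :: nat
proof
  fix i j k l :: nat
  show "theta c j i = - theta c i j"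
    unfolding theta_def by (rule gen2_swap)
  show "theta c i j * theta c k l = - (theta c i k * theta c j l)"
    unfolding theta_def by (rule gen2_exchange)
  show "eta c j i = - eta c i j"
    using gen2_swap[of j i] by (simp add: eta_def)
  show "eta c i j * eta c k l = - (eta c i k * eta c j l)"
    using gen2_exchange[of i j k l] by (simp add: eta_def)
  show "ecoeff (theta c i j) {} = 0"
    unfolding theta_def using ecoeff_gen2_nonzero by blast
  show "fil {..<c} 2 (eta c i j)"
    unfolding fil_def
  proof (intro allI impI)
    fix I assume "ecoeff (eta c i j) I \<noteq> 0"
    then have "I = {i, j} \<and> i \<noteq> j \<and> i < c \<and> j < c"
      using ecoeff_gen2_nonzero[of i j I] by (auto simp: eta_def split: if_splits)
    then show "2 \<le> card (I \<inter> {..<c})" by auto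
  qed
qed

text \<open>A monomial up to sign and a factor with constant term 1. This form absorbs the
  \<open>sigma\<close> factors and still fixes the coefficient at I up to sign.\<close>

definition unit_mon :: "nat set \<Rightarrow> even_ext \<Rightarrow> bool" where
  "unit_mon I r \<longleftrightarrow> (\<exists>d s. \<bar>d\<bar> = 1 \<and> ecoeff s {} = 1 \<and> r = of_int d * (s * emon I))"

lemma unit_monI: "\<bar>d\<bar> = 1 \<Longrightarrow> ecoeff s {} = 1 \<Longrightarrow> r = of_int d * (s * emon I) \<Longrightarrow> unit_mon I r"
  unfolding unit_mon_def by blast

lemma emon_mult_bil: "emon I * bil f S {h} = (\<Sum>i\<in>S. emon I * f i h)"
  by (simp add: bil_def sum_distrib_left)

text \<open>In the next two lemmas, \<open>I\<close> contains all but one of the generators of one kind that belong to \<open>S\<close>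
  and all those of the other kind. So only the missing one, \<open>x\<close> or \<open>y\<close>, contributes to the commutator.\<close>

lemma unit_mon_pcomm_theta:
  assumes "finite T" "x \<notin> T" "h \<notin> insert x T"
    and "unit_mon ((+) c ` T \<union> (insert x T \<inter> {..<c})) r"
  shows "\<exists>r'. tw.pcomm c (r, insert x T) (1, {h}) = (r', insert h (insert x T)) \<and>
    unit_mon ((+) c ` insert h (insert x T) \<union> (insert x T \<inter> {..<c})) r'"
proof -
  let ?S = "insert x T" and ?I = "(+) c ` T \<union> (insert x T \<inter> {..<c})"
  let ?J = "(+) c ` insert h (insert x T) \<union> (insert x T \<inter> {..<c})"
  let ?p = "bil (theta c) ?S {h}" and ?q = "bil (eta c) ?S {h}" and ?s = "tw.sigma c {h} ?S"
  obtain d s where ds: "\<bar>d\<bar> = 1" "ecoeff s {} = 1" "r = of_int d * (s * emon ?I)"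
    using assms(4) unfolding unit_mon_def by blast
  \<comment> \<open>All \<open>eta\<close> generators belonging to \<open>?S\<close> are already in
    \<open>?I\<close>. The mixed term vanishes for the same reason.\<close>
  have q: "emon ?I * ?q = 0"
    unfolding emon_mult_bil by (rule sum.neutral) (auto simp: eta_def emon_mult_gen2_eq_0)
  have "emon ?I * theta c i h = 0" if "i \<in> T" for i
    unfolding theta_def by (rule emon_mult_gen2_eq_0) (use that in auto)
  then have "emon ?I * ?p = emon ?I * gen2 (c + x) (c + h)"
    unfolding emon_mult_bil using assms by (simp add: theta_def)
  moreover have fresh: "c + x \<noteq> c + h" "c + x \<notin> ?I" "c + h \<notin> ?I"
    using assms by auto
  obtain d' where d': "\<bar>d'\<bar> = 1"
    "emon ?I * gen2 (c + x) (c + h) = of_int d' * emon (insert (c + x) (insert (c + h) ?I))"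
    using emon_mult_gen2[OF fresh] by blast
  moreover have "insert (c + x) (insert (c + h) ?I) = ?J" by auto
  ultimately have p: "emon ?I * ?p = of_int d' * emon ?J" by simp
  define r' where "r' = r * 1 * ?s * (?p + ?q + ?p * ?q)"
  have "tw.pcomm c (r, ?S) (1, {h}) = (r', ?S \<union> {h})"
    unfolding r'_def by (rule tw.pcomm_disjoint) (use assms in auto)
  moreover have "unit_mon ?J r'"
  proof (rule unit_monI)
    have "r' = of_int d * (s * ?s) * (emon ?I * ?p + emon ?I * ?q * (1 + ?p))"
      unfolding r'_def ds by (simp only: algebra_simps mult_1 mult_1_right)
    also have "\<dots> = of_int (d * d') * ((s * ?s) * emon ?J)"
      by (simp only: p q) (simp add: mult.assoc mult.commute mult.left_commute)
    finally show "r' = of_int (d * d') * ((s * ?s) * emon ?J)" .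
    show "\<bar>d * d'\<bar> = 1" using ds d' by (simp add: abs_mult)
    show "ecoeff (s * ?s) {} = 1" using ds by (simp add: ecoeff_mult_empty tw.ecoeff_sigma_empty)
  qed
  ultimately show ?thesis by simp
qed

lemma unit_mon_pcomm_eta:
  assumes "finite T" "y \<notin> T" "h \<notin> insert y T" "y < c" "h < c"
    and "unit_mon ((+) c ` insert y T \<union> (T \<inter> {..<c})) r"
  shows "\<exists>r'. tw.pcomm c (r, insert y T) (1, {h}) = (r', insert h (insert y T)) \<and>
    unit_mon ((+) c ` insert y T \<union> (insert h (insert y T) \<inter> {..<c})) r'"
proof -
  let ?S = "insert y T" and ?I = "(+) c ` insert y T \<union> (T \<inter> {..<c})"
  let ?J = "(+) c ` insert y T \<union> (insert h (insert y T) \<inter> {..<c})"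
  let ?p = "bil (theta c) ?S {h}" and ?q = "bil (eta c) ?S {h}" and ?s = "tw.sigma c {h} ?S"
  obtain d s where ds: "\<bar>d\<bar> = 1" "ecoeff s {} = 1" "r = of_int d * (s * emon ?I)"
    using assms(6) unfolding unit_mon_def by blast
  have p: "emon ?I * ?p = 0"
    unfolding emon_mult_bil by (rule sum.neutral) (auto simp: theta_def emon_mult_gen2_eq_0)
  have "emon ?I * eta c i h = 0" if "i \<in> T" for i
    using that by (auto simp: eta_def emon_mult_gen2_eq_0)
  then have "emon ?I * ?q = emon ?I * gen2 y h"
    unfolding emon_mult_bil using assms by (simp add: eta_def)
  also obtain d' where d': "\<bar>d'\<bar> = 1"
    "emon ?I * gen2 y h = of_int d' * emon (insert y (insert h ?I))"
    using emon_mult_gen2[of y h ?I] assms by auto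
  note d'(2)
  also have "insert y (insert h ?I) = ?J" using assms by auto
  finally have q: "emon ?I * ?q = of_int d' * emon ?J" .
  define r' where "r' = r * 1 * ?s * (?p + ?q + ?p * ?q)"
  have "tw.pcomm c (r, ?S) (1, {h}) = (r', ?S \<union> {h})"
    unfolding r'_def by (rule tw.pcomm_disjoint) (use assms in auto)
  moreover have "unit_mon ?J r'"
  proof (rule unit_monI)
    have "r' = of_int d * (s * ?s) * (emon ?I * ?q + emon ?I * ?p * (1 + ?q))"
      unfolding r'_def ds by (simp only: algebra_simps mult_1 mult_1_right)
    also have "\<dots> = of_int (d * d') * ((s * ?s) * emon ?J)"
      by (simp only: p q) (simp add: mult.assoc mult.commute mult.left_commute)
    finally show "r' = of_int (d * d') * ((s * ?s) * emon ?J)" .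
    show "\<bar>d * d'\<bar> = 1" using ds d' by (simp add: abs_mult)
    show "ecoeff (s * ?s) {} = 1" using ds by (simp add: ecoeff_mult_empty tw.ecoeff_sigma_empty)
  qed
  ultimately show ?thesis by simp
qed

text \<open>Each round appends two entries, the first giving a \<open>theta\<close> factor and the
  second an \<open>eta\<close> factor. The entry whose \<open>theta\<close> generator is still
  missing is x: at the start a, which has no \<open>eta\<close> generator as a \<ge> c, and
  afterwards the last entry.\<close>

lemma unit_mon_foldl_pcomm:
  assumes "c \<le> a" "p + 2 * q \<le> c"
  shows "\<exists>r x T. foldl (tw.pcomm c) (1, {a}) (map (\<lambda>i. (1, {i})) [p..<p + 2 * q]) = (r, insert x T) \<and>
    finite T \<and> x \<notin> T \<and> insert x T = insert a {p..<p + 2 * q} \<and>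
    unit_mon ((+) c ` T \<union> (insert x T \<inter> {..<c})) r"
  using assms(2)
proof (induction q)
  case 0
  have "unit_mon {} 1"
    by (rule unit_monI[of 1 1]) (simp_all add: ecoeff_one one_even_ext_def[symmetric])
  then show ?case
    using assms(1) by (intro exI[of _ 1] exI[of _ a] exI[of _ "{}"]) simp
next
  case (Suc q)
  let ?u = "p + 2 * q"
  have le: "?u + 1 < c" using Suc.prems by simp
  obtain r x T where IH: "foldl (tw.pcomm c) (1, {a}) (map (\<lambda>i. (1, {i})) [p..<?u]) = (r, insert x T)"
    "finite T" "x \<notin> T" "insert x T = insert a {p..<?u}"
    "unit_mon ((+) c ` T \<union> (insert x T \<inter> {..<c})) r"
    using Suc by auto
  have "?u \<notin> insert x T" unfolding IH(4) using assms(1) le by auto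
  from unit_mon_pcomm_theta[OF IH(2,3) this IH(5)]
  obtain r1 where r1: "tw.pcomm c (r, insert x T) (1, {?u}) = (r1, insert ?u (insert x T))"
    "unit_mon ((+) c ` insert ?u (insert x T) \<union> (insert x T \<inter> {..<c})) r1" by blast
  have notin: "?u \<notin> insert x T" "?u + 1 \<notin> insert ?u (insert x T)"
    unfolding IH(4) using assms(1) le by auto
  have "finite (insert x T)" using IH(2) by simp
  \<comment> \<open>Now only the \<open>eta\<close> generator of \<open>?u\<close> is missing, so
    \<open>?u\<close> takes the role of y.\<close>
  from unit_mon_pcomm_eta[OF this notin _ le r1(2)] le
  obtain r2 where r2: "tw.pcomm c (r1, insert ?u (insert x T)) (1, {?u + 1})
      = (r2, insert (?u + 1) (insert ?u (insert x T)))"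
    "unit_mon ((+) c ` insert ?u (insert x T) \<union> (insert (?u + 1) (insert ?u (insert x T)) \<inter> {..<c})) r2"
    by auto
  have list: "[p..<p + 2 * Suc q] = [p..<?u] @ [?u, ?u + 1]"
    by (simp add: upt_Suc_append)
  have "insert (?u + 1) (insert ?u (insert x T)) = insert a {p..<p + 2 * Suc q}"
    unfolding IH(4) by auto
  then show ?case
    using r1 r2 notin IH(1,2) unfolding list
    by (intro exI[of _ r2] exI[of _ "?u + 1"] exI[of _ "insert ?u (insert x T)"]) simp
qed

text \<open>A last \<open>theta\<close> step with b \<ge> c brings no new \<open>eta\<close>
  generator and completes the monomial. The \<open>eta\<close> degree is 2q for a commutator of
  length 2q + 2.\<close>

lemma unit_mon_foldl_pcomm_final:
  assumes "c \<le> a" "c \<le> b" "a \<noteq> b" "p + 2 * q \<le> c"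
  defines "S \<equiv> {a, b} \<union> {p..<p + 2 * q}"
  shows "\<exists>r. foldl (tw.pcomm c) (1, {a}) (map (\<lambda>i. (1, {i})) ([p..<p + 2 * q] @ [b])) = (r, S) \<and>
    unit_mon ((+) c ` S \<union> (S \<inter> {..<c})) r"
proof -
  obtain r x T where *: "foldl (tw.pcomm c) (1, {a}) (map (\<lambda>i. (1, {i})) [p..<p + 2 * q]) = (r, insert x T)"
    "finite T" "x \<notin> T" "insert x T = insert a {p..<p + 2 * q}"
    "unit_mon ((+) c ` T \<union> (insert x T \<inter> {..<c})) r"
    using unit_mon_foldl_pcomm[OF assms(1,4)] by blast
  have "b \<notin> insert x T" unfolding *(4) using assms by auto
  from unit_mon_pcomm_theta[OF *(2,3) this *(5)]
  obtain r1 where r1: "tw.pcomm c (r, insert x T) (1, {b}) = (r1, insert b (insert x T))"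
    "unit_mon ((+) c ` insert b (insert x T) \<union> (insert x T \<inter> {..<c})) r1" by blast
  have "insert x T \<inter> {..<c} = S \<inter> {..<c}" "insert b (insert x T) = S"
    unfolding *(4) S_def using assms(1,2) by auto
  then show ?thesis using r1 *(1) by simp
qed

lemma unit_mon_mult:
  assumes "unit_mon I r" "unit_mon J r'" "ecoeff t {} = 1" "I \<inter> J = {}"
    and "finite I" "finite J" "even (card I)" "even (card J)"
  shows "unit_mon (I \<union> J) (r * r' * t)"
proof -
  obtain d s where ds: "\<bar>d\<bar> = 1" "ecoeff s {} = 1" "r = of_int d * (s * emon I)"
    using assms(1) unfolding unit_mon_def by blast
  obtain d' s' where ds': "\<bar>d'\<bar> = 1" "ecoeff s' {} = 1" "r' = of_int d' * (s' * emon J)"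
    using assms(2) unfolding unit_mon_def by blast
  show ?thesis
  proof (rule unit_monI)
    have "r * r' * t = of_int (d * d') * (s * s' * t) * (emon I * emon J)"
      unfolding ds ds' by (simp add: ac_simps)
    also have "\<dots> = of_int (d * d' * order_sign I J) * ((s * s' * t) * emon (I \<union> J))"
      using assms by (simp add: emon_mult ac_simps)
    finally show "r * r' * t = of_int (d * d' * order_sign I J) * ((s * s' * t) * emon (I \<union> J))" .
    show "\<bar>d * d' * order_sign I J\<bar> = 1"
      using ds ds' order_sign_cases[of I J] by (auto simp: abs_mult)
    show "ecoeff (s * s' * t) {} = 1"
      using ds ds' assms by (simp add: ecoeff_mult_empty)
  qed
qed

text \<open>Only the constant term of s contributes at I, as its other terms turn
  \<open>emon I\<close> into larger monomials or 0.\<close>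

lemma unit_mon_ecoeff:
  assumes "unit_mon I r" "finite I" "even (card I)"
  shows "\<bar>ecoeff r I\<bar> = 1"
proof -
  obtain d s where ds: "\<bar>d\<bar> = 1" "ecoeff s {} = 1" "r = of_int d * (s * emon I)"
    using assms(1) unfolding unit_mon_def by blast
  have "ecoeff r I = ecoeff (of_int d * (emon I * s)) I" by (simp add: ds(3) ac_simps)
  also have "\<dots> = d"
    using ds(2) assms by (simp only: ecoeff_of_int_mult) (simp add: ecoeff_emon_mult)
  finally show ?thesis using ds(1) by simp
qed

section \<open>Extension of scalars\<close>

context module
begin

inductive_set lin_span :: "'c set \<Rightarrow> 'c set" for B where
  zero: "\<zero>\<^bsub>M\<^esub> \<in> lin_span B"
| base: "b \<in> B \<Longrightarrow> b \<in> lin_span B"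
| add: "x \<in> lin_span B \<Longrightarrow> y \<in> lin_span B \<Longrightarrow> x \<oplus>\<^bsub>M\<^esub> y \<in> lin_span B"
| smult: "a \<in> carrier R \<Longrightarrow> x \<in> lin_span B \<Longrightarrow> a \<odot>\<^bsub>M\<^esub> x \<in> lin_span B"

lemma lin_span_closed:
  assumes "x \<in> lin_span B" "B \<subseteq> carrier M"
  shows "x \<in> carrier M"
  using assms(1) by induction (use assms(2) in auto)

end

text \<open>Multiplication of coordinate vectors, where \<open>cs i j u\<close> is the coordinate at
  u of the product of the basis vectors i and j.\<close>

definition conv :: "nat set \<Rightarrow> (nat \<Rightarrow> nat \<Rightarrow> nat \<Rightarrow> int) \<Rightarrow> (nat \<Rightarrow> int) \<Rightarrow> (nat \<Rightarrow> int) \<Rightarrow> nat \<Rightarrow> int" where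
  "conv J cs x y u = (if u \<in> J then \<Sum>(i, j)\<in>J \<times> J. cs i j u * (x i * y j) else 0)"

definition unit_vec :: "nat \<Rightarrow> nat \<Rightarrow> int" where
  "unit_vec i j = (if j = i then 1 else 0)"

text \<open>Base change to F of a multiplication on the free abelian group with finite basis J; e
  holds the coordinates of its unit.\<close>

locale int_base_change = cring F for F (structure) +
  fixes J :: "nat set" and cs :: "nat \<Rightarrow> nat \<Rightarrow> nat \<Rightarrow> int" and e :: "nat \<Rightarrow> int"
  assumes finite_J: "finite J"
begin

definition emb :: "int \<Rightarrow> 'a" where
  "emb z = add_pow F z \<one>"

definition ext :: "(nat \<Rightarrow> int) \<Rightarrow> nat \<Rightarrow> 'a" where
  "ext x i = (if i \<in> J then emb (x i) else \<zero>)"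

text \<open>Vectors are 0 outside J, so that equality of functions is equality of
  coordinates.\<close>

definition alg :: "('a, nat \<Rightarrow> 'a) module" where
  "alg = \<lparr>partial_object.carrier = {f. (\<forall>i\<in>J. f i \<in> carrier F) \<and> (\<forall>i. i \<notin> J \<longrightarrow> f i = \<zero>)},
     monoid.mult = (\<lambda>f g u. if u \<in> J then \<Oplus>p\<in>J \<times> J. emb (cs (fst p) (snd p) u) \<otimes> (f (fst p) \<otimes> g (snd p)) else \<zero>),
     monoid.one = ext e, ring.zero = (\<lambda>_. \<zero>), ring.add = (\<lambda>f g i. f i \<oplus> g i),
     module.smult = (\<lambda>a f i. a \<otimes> f i)\<rparr>"

lemma emb_closed [simp]: "emb z \<in> carrier F"
  by (simp add: emb_def)

lemma emb_0 [simp]: "emb 0 = \<zero>"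
  by (simp add: emb_def add_pow_def)

lemma emb_1 [simp]: "emb 1 = \<one>"
  by (simp add: emb_def)

lemma emb_add: "emb (a + b) = emb a \<oplus> emb b"
  by (simp add: emb_def add.int_pow_mult)

lemma emb_minus: "emb (- a) = \<ominus> emb a"
  by (simp add: emb_def add.int_pow_neg)

lemma emb_mult: "emb (a * b) = emb a \<otimes> emb b"
proof -
  have "emb a \<otimes> emb b = add_pow F a (\<one> \<otimes> add_pow F b \<one>)"
    unfolding emb_def by (rule add_pow_ldistr_int) simp_all
  then show ?thesis by (simp add: emb_def add.int_pow_pow mult.commute)
qed

lemma emb_sum: "emb (sum h A) = (\<Oplus>a\<in>A. emb (h a))"
  by (induction A rule: infinite_finite_induct) (auto simp: emb_add)

lemma carrier_alg: "f \<in> carrier alg \<longleftrightarrow> (\<forall>i\<in>J. f i \<in> carrier F) \<and> (\<forall>i. i \<notin> J \<longrightarrow> f i = \<zero>)"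
  by (simp add: alg_def)

lemma alg_closed: "f \<in> carrier alg \<Longrightarrow> f i \<in> carrier F"
  unfolding carrier_alg by (cases "i \<in> J") auto

lemma alg_simps:
  "\<zero>\<^bsub>alg\<^esub> = (\<lambda>_. \<zero>)" "f \<oplus>\<^bsub>alg\<^esub> g = (\<lambda>i. f i \<oplus> g i)" "a \<odot>\<^bsub>alg\<^esub> f = (\<lambda>i. a \<otimes> f i)"
  "\<one>\<^bsub>alg\<^esub> = ext e"
  by (simp_all add: alg_def)

lemma alg_mult: "(f \<otimes>\<^bsub>alg\<^esub> g) u = (if u \<in> J
    then \<Oplus>p\<in>J \<times> J. emb (cs (fst p) (snd p) u) \<otimes> (f (fst p) \<otimes> g (snd p)) else \<zero>)"
  by (simp add: alg_def)

lemma ext_closed: "ext x \<in> carrier alg"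
  by (simp add: carrier_alg ext_def)

lemma abelian_group_alg: "abelian_group alg"
proof (rule abelian_groupI)
  fix x y z assume xyz: "x \<in> carrier alg" "y \<in> carrier alg" "z \<in> carrier alg"
  note [simp] = alg_closed[OF xyz(1)] alg_closed[OF xyz(2)] alg_closed[OF xyz(3)]
  show "x \<oplus>\<^bsub>alg\<^esub> y \<oplus>\<^bsub>alg\<^esub> z = x \<oplus>\<^bsub>alg\<^esub> (y \<oplus>\<^bsub>alg\<^esub> z)"
    by (simp add: alg_simps a_assoc)
next
  fix x y assume xy: "x \<in> carrier alg" "y \<in> carrier alg"
  note [simp] = alg_closed[OF xy(1)] alg_closed[OF xy(2)]
  show "x \<oplus>\<^bsub>alg\<^esub> y = y \<oplus>\<^bsub>alg\<^esub> x"
    by (simp add: alg_simps a_comm)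
  show "x \<oplus>\<^bsub>alg\<^esub> y \<in> carrier alg"
    using xy by (simp add: alg_simps carrier_alg)
next
  fix x assume x: "x \<in> carrier alg"
  have "(\<lambda>i. \<ominus> x i) \<in> carrier alg" using x by (simp add: carrier_alg)
  moreover have "(\<lambda>i. \<ominus> x i) \<oplus>\<^bsub>alg\<^esub> x = \<zero>\<^bsub>alg\<^esub>"
    using alg_closed[OF x] by (simp add: alg_simps l_neg)
  ultimately show "\<exists>y\<in>carrier alg. y \<oplus>\<^bsub>alg\<^esub> x = \<zero>\<^bsub>alg\<^esub>" by blast
  show "\<zero>\<^bsub>alg\<^esub> \<oplus>\<^bsub>alg\<^esub> x = x"
    using alg_closed[OF x] by (simp add: alg_simps)
qed (simp add: alg_simps carrier_alg)

lemma module_alg: "module F alg"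
proof (rule moduleI)
  show "cring F" by (rule is_cring)
  show "abelian_group alg" by (rule abelian_group_alg)
next
  fix a x assume ax: "a \<in> carrier F" "x \<in> carrier alg"
  then show "a \<odot>\<^bsub>alg\<^esub> x \<in> carrier alg"
    by (simp add: alg_simps carrier_alg)
  fix b assume b: "b \<in> carrier F"
  note [simp] = ax(1) b alg_closed[OF ax(2)]
  show "(a \<oplus> b) \<odot>\<^bsub>alg\<^esub> x = a \<odot>\<^bsub>alg\<^esub> x \<oplus>\<^bsub>alg\<^esub> b \<odot>\<^bsub>alg\<^esub> x"
    by (simp add: alg_simps l_distr)
  show "(a \<otimes> b) \<odot>\<^bsub>alg\<^esub> x = a \<odot>\<^bsub>alg\<^esub> (b \<odot>\<^bsub>alg\<^esub> x)"
    by (simp add: alg_simps m_assoc)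
next
  fix a x y assume axy: "a \<in> carrier F" "x \<in> carrier alg" "y \<in> carrier alg"
  note [simp] = axy(1) alg_closed[OF axy(2)] alg_closed[OF axy(3)]
  show "a \<odot>\<^bsub>alg\<^esub> (x \<oplus>\<^bsub>alg\<^esub> y) = a \<odot>\<^bsub>alg\<^esub> x \<oplus>\<^bsub>alg\<^esub> a \<odot>\<^bsub>alg\<^esub> y"
    by (simp add: alg_simps r_distr)
next
  fix x assume "x \<in> carrier alg"
  then show "\<one> \<odot>\<^bsub>alg\<^esub> x = x"
    using alg_closed by (simp add: alg_simps)
qed

sublocale A: module F alg
  by (rule module_alg)

lemma mult_closed: "f \<in> carrier alg \<Longrightarrow> g \<in> carrier alg \<Longrightarrow> f \<otimes>\<^bsub>alg\<^esub> g \<in> carrier alg"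
  by (auto simp: carrier_alg alg_mult intro!: finsum_closed)

lemma mult_l_distr:
  assumes "f \<in> carrier alg" "f' \<in> carrier alg" "g \<in> carrier alg"
  shows "(f \<oplus>\<^bsub>alg\<^esub> f') \<otimes>\<^bsub>alg\<^esub> g = f \<otimes>\<^bsub>alg\<^esub> g \<oplus>\<^bsub>alg\<^esub> f' \<otimes>\<^bsub>alg\<^esub> g"
proof
  fix u
  note [simp] = alg_closed[OF assms(1)] alg_closed[OF assms(2)] alg_closed[OF assms(3)]
  show "((f \<oplus>\<^bsub>alg\<^esub> f') \<otimes>\<^bsub>alg\<^esub> g) u = (f \<otimes>\<^bsub>alg\<^esub> g \<oplus>\<^bsub>alg\<^esub> f' \<otimes>\<^bsub>alg\<^esub> g) u"
    by (simp add: alg_simps alg_mult l_distr r_distr finsum_addf)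
qed

lemma mult_r_distr:
  assumes "f \<in> carrier alg" "f' \<in> carrier alg" "g \<in> carrier alg"
  shows "g \<otimes>\<^bsub>alg\<^esub> (f \<oplus>\<^bsub>alg\<^esub> f') = g \<otimes>\<^bsub>alg\<^esub> f \<oplus>\<^bsub>alg\<^esub> g \<otimes>\<^bsub>alg\<^esub> f'"
proof
  fix u
  note [simp] = alg_closed[OF assms(1)] alg_closed[OF assms(2)] alg_closed[OF assms(3)]
  show "(g \<otimes>\<^bsub>alg\<^esub> (f \<oplus>\<^bsub>alg\<^esub> f')) u = (g \<otimes>\<^bsub>alg\<^esub> f \<oplus>\<^bsub>alg\<^esub> g \<otimes>\<^bsub>alg\<^esub> f') u"
    by (simp add: alg_simps alg_mult r_distr finsum_addf)
qed

lemma mult_smult_left: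
  assumes "a \<in> carrier F" "f \<in> carrier alg" "g \<in> carrier alg"
  shows "(a \<odot>\<^bsub>alg\<^esub> f) \<otimes>\<^bsub>alg\<^esub> g = a \<odot>\<^bsub>alg\<^esub> (f \<otimes>\<^bsub>alg\<^esub> g)"
proof
  fix u
  note [simp] = assms(1) alg_closed[OF assms(2)] alg_closed[OF assms(3)]
  show "((a \<odot>\<^bsub>alg\<^esub> f) \<otimes>\<^bsub>alg\<^esub> g) u = (a \<odot>\<^bsub>alg\<^esub> (f \<otimes>\<^bsub>alg\<^esub> g)) u"
    using finite_J by (simp add: alg_simps alg_mult finsum_rdistr m_ac)
qed

lemma mult_smult_right:
  assumes "a \<in> carrier F" "f \<in> carrier alg" "g \<in> carrier alg"
  shows "f \<otimes>\<^bsub>alg\<^esub> (a \<odot>\<^bsub>alg\<^esub> g) = a \<odot>\<^bsub>alg\<^esub> (f \<otimes>\<^bsub>alg\<^esub> g)"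
proof
  fix u
  note [simp] = assms(1) alg_closed[OF assms(2)] alg_closed[OF assms(3)]
  show "(f \<otimes>\<^bsub>alg\<^esub> (a \<odot>\<^bsub>alg\<^esub> g)) u = (a \<odot>\<^bsub>alg\<^esub> (f \<otimes>\<^bsub>alg\<^esub> g)) u"
    using finite_J by (simp add: alg_simps alg_mult finsum_rdistr m_ac)
qed

text \<open>The map \<open>emb\<close> is a ring homomorphism, so products computed over the
  integers carry over to \<open>alg\<close>.\<close>

lemma ext_mult: "ext x \<otimes>\<^bsub>alg\<^esub> ext y = ext (conv J cs x y)"
proof
  fix u
  show "(ext x \<otimes>\<^bsub>alg\<^esub> ext y) u = ext (conv J cs x y) u"
  proof (cases "u \<in> J")
    case True
    have "emb (conv J cs x y u) = (\<Oplus>p\<in>J \<times> J. emb (cs (fst p) (snd p) u) \<otimes> (ext x (fst p) \<otimes> ext y (snd p)))"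
      unfolding conv_def using True
      by (simp add: emb_sum case_prod_unfold)
        (intro finsum_cong, auto simp: ext_def emb_mult simp_implies_def)
    then show ?thesis using True by (simp add: alg_mult ext_def)
  qed (simp add: alg_mult ext_def)
qed

lemma ext_minus: "ext x \<ominus>\<^bsub>alg\<^esub> ext y = ext (\<lambda>i. x i - y i)"
proof -
  have "ext (\<lambda>i. - y i) \<oplus>\<^bsub>alg\<^esub> ext y = \<zero>\<^bsub>alg\<^esub>"
    by (simp add: alg_simps ext_def fun_eq_iff emb_minus l_neg)
  then have "\<ominus>\<^bsub>alg\<^esub> ext y = ext (\<lambda>i. - y i)"
    by (intro abelian_group.minus_equality[OF abelian_group_alg] ext_closed)
  moreover have "ext x \<oplus>\<^bsub>alg\<^esub> ext (\<lambda>i. - y i) = ext (\<lambda>i. x i - y i)"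
    by (simp add: alg_simps ext_def fun_eq_iff flip: emb_add)
  ultimately show ?thesis by (simp add: a_minus_def)
qed

lemma alg_span: "carrier alg \<subseteq> A.lin_span ((\<lambda>i. ext (unit_vec i)) ` J)"
proof
  have "finite Y \<Longrightarrow> Y \<subseteq> J \<Longrightarrow> f \<in> carrier alg \<Longrightarrow> (\<And>i. i \<notin> Y \<Longrightarrow> f i = \<zero>)
    \<Longrightarrow> f \<in> A.lin_span ((\<lambda>i. ext (unit_vec i)) ` J)" for f Y
  proof (induction Y arbitrary: f rule: finite_induct)
    case empty
    then have "f = \<zero>\<^bsub>alg\<^esub>" by (auto simp: alg_simps)
    then show ?case by (simp add: A.lin_span.zero)
  next
    case (insert i Y)
    define f' where "f' = (\<lambda>j. if j = i then \<zero> else f j)"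
    have "f' \<in> A.lin_span ((\<lambda>i. ext (unit_vec i)) ` J)"
      using insert by (intro insert.IH) (auto simp: f'_def carrier_alg)
    moreover have "f i \<odot>\<^bsub>alg\<^esub> ext (unit_vec i) \<in> A.lin_span ((\<lambda>i. ext (unit_vec i)) ` J)"
      using insert alg_closed by (intro A.lin_span.smult A.lin_span.base) auto
    moreover have "f i \<odot>\<^bsub>alg\<^esub> ext (unit_vec i) \<oplus>\<^bsub>alg\<^esub> f' = f"
      using insert alg_closed[OF insert.prems(2)]
      by (auto simp: alg_simps f'_def ext_def unit_vec_def fun_eq_iff)
    ultimately show ?case using A.lin_span.add by metis
  qed
  from this[OF finite_J order.refl]
  show "f \<in> A.lin_span ((\<lambda>i. ext (unit_vec i)) ` J)" if "f \<in> carrier alg" for f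
    using that carrier_alg by blast
qed

lemma mult_zero:
  assumes "f \<in> carrier alg"
  shows "\<zero>\<^bsub>alg\<^esub> \<otimes>\<^bsub>alg\<^esub> f = \<zero>\<^bsub>alg\<^esub>" "f \<otimes>\<^bsub>alg\<^esub> \<zero>\<^bsub>alg\<^esub> = \<zero>\<^bsub>alg\<^esub>"
  using alg_closed[OF assms] by (auto simp: fun_eq_iff alg_mult alg_simps)

text \<open>By bilinearity the axioms reduce to basis vectors, where they are integer identities
  carried over by \<open>ext_mult\<close>.\<close>

lemma unital_assoc_algebra_alg:
  assumes assoc: "\<And>i j k. i \<in> J \<Longrightarrow> j \<in> J \<Longrightarrow> k \<in> J \<Longrightarrow>
      conv J cs (conv J cs (unit_vec i) (unit_vec j)) (unit_vec k)
      = conv J cs (unit_vec i) (conv J cs (unit_vec j) (unit_vec k))"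
    and unit: "\<And>i. i \<in> J \<Longrightarrow> conv J cs e (unit_vec i) = unit_vec i"
      "\<And>i. i \<in> J \<Longrightarrow> conv J cs (unit_vec i) e = unit_vec i"
  shows "unital_assoc_algebra F alg"
proof -
  let ?B = "(\<lambda>i. ext (unit_vec i)) ` J"
  have B: "?B \<subseteq> carrier alg" using ext_closed by auto
  have span: "x \<in> A.lin_span ?B" if "x \<in> carrier alg" for x
    using alg_span that by blast
  note closed = A.lin_span_closed[OF _ B] mult_closed ext_closed A.smult_closed A.M.add.m_closed
  note distr = mult_zero mult_l_distr mult_r_distr mult_smult_left mult_smult_right
  \<comment> \<open>The three arguments are extended from basis vectors to the span one after the
    other.\<close>
  have assoc1: "(x \<otimes>\<^bsub>alg\<^esub> y) \<otimes>\<^bsub>alg\<^esub> z = x \<otimes>\<^bsub>alg\<^esub> (y \<otimes>\<^bsub>alg\<^esub> z)"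
    if "x \<in> A.lin_span ?B" "y \<in> ?B" "z \<in> ?B" for x y z
    using that(1)
  proof induction
    case (base b)
    then show ?case using that(2,3) by (auto simp: ext_mult assoc)
  qed (use that B in \<open>auto simp: distr closed subset_iff\<close>)
  have assoc2: "(x \<otimes>\<^bsub>alg\<^esub> y) \<otimes>\<^bsub>alg\<^esub> z = x \<otimes>\<^bsub>alg\<^esub> (y \<otimes>\<^bsub>alg\<^esub> z)"
    if "x \<in> A.lin_span ?B" "y \<in> A.lin_span ?B" "z \<in> ?B" for x y z
    using that(2)
  proof induction
    case (base b)
    then show ?case using that assoc1 by blast
  qed (use that B in \<open>auto simp: distr closed subset_iff\<close>)
  have assoc3: "(x \<otimes>\<^bsub>alg\<^esub> y) \<otimes>\<^bsub>alg\<^esub> z = x \<otimes>\<^bsub>alg\<^esub> (y \<otimes>\<^bsub>alg\<^esub> z)"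
    if "x \<in> A.lin_span ?B" "y \<in> A.lin_span ?B" "z \<in> A.lin_span ?B" for x y z
    using that(3)
  proof induction
    case (base b)
    then show ?case using that assoc2 by blast
  qed (use that in \<open>auto simp: distr closed\<close>)
  have unit1: "\<one>\<^bsub>alg\<^esub> \<otimes>\<^bsub>alg\<^esub> x = x" if "x \<in> A.lin_span ?B" for x
    using that
  proof induction
    case (base b)
    then show ?case by (auto simp: alg_simps(4) ext_mult unit)
  qed (auto simp: alg_simps(4) distr closed)
  have unit2: "x \<otimes>\<^bsub>alg\<^esub> \<one>\<^bsub>alg\<^esub> = x" if "x \<in> A.lin_span ?B" for x
    using that
  proof induction
    case (base b)
    then show ?case by (auto simp: alg_simps(4) ext_mult unit)
  qed (auto simp: alg_simps(4) distr closed)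
  have "ring alg"
  proof (rule ringI)
    show "abelian_group alg" by (rule abelian_group_alg)
    show "Group.monoid alg"
    proof (rule monoidI)
      show "\<one>\<^bsub>alg\<^esub> \<in> carrier alg" by (simp add: alg_simps(4) ext_closed)
    qed (simp_all add: mult_closed assoc3 unit1 unit2 span)
  qed (simp_all add: distr)
  then show ?thesis
    by (intro unital_assoc_algebra.intro module_alg unital_assoc_algebra_axioms.intro)
      (simp_all add: distr)
qed

end

section \<open>Bilinearity of the commutator\<close>

context unital_assoc_algebra
begin

lemma commutator_closed [simp]:
  "x \<in> carrier A \<Longrightarrow> y \<in> carrier A \<Longrightarrow> commutator A x y \<in> carrier A"
  by (simp add: commutator_def)

lemma commutator_zero [simp]:
  "x \<in> carrier A \<Longrightarrow> commutator A \<zero>\<^bsub>A\<^esub> x = \<zero>\<^bsub>A\<^esub>"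
  "x \<in> carrier A \<Longrightarrow> commutator A x \<zero>\<^bsub>A\<^esub> = \<zero>\<^bsub>A\<^esub>"
  by (simp_all add: commutator_def a_minus_def)

lemma commutator_add:
  assumes "x \<in> carrier A" "y \<in> carrier A" "z \<in> carrier A"
  shows "commutator A (x \<oplus>\<^bsub>A\<^esub> y) z = commutator A x z \<oplus>\<^bsub>A\<^esub> commutator A y z"
    and "commutator A z (x \<oplus>\<^bsub>A\<^esub> y) = commutator A z x \<oplus>\<^bsub>A\<^esub> commutator A z y"
  using assms by (simp_all add: commutator_def a_minus_def l_distr r_distr minus_add a_ac)

lemma commutator_smult:
  assumes "a \<in> carrier F" "x \<in> carrier A" "y \<in> carrier A"
  shows "commutator A (a \<odot>\<^bsub>A\<^esub> x) y = a \<odot>\<^bsub>A\<^esub> commutator A x y"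
    and "commutator A x (a \<odot>\<^bsub>A\<^esub> y) = a \<odot>\<^bsub>A\<^esub> commutator A x y"
  using assms
  by (simp_all add: commutator_def a_minus_def smult_mult_left smult_mult_right smult_r_distr smult_r_minus)

lemma commutator_lin_span:
  assumes P: "P \<subseteq> carrier A" and Q: "Q \<subseteq> carrier A"
    and PQ: "\<And>p q. p \<in> P \<Longrightarrow> q \<in> Q \<Longrightarrow> commutator A p q \<in> lin_span B"
    and x: "x \<in> lin_span P" and y: "y \<in> lin_span Q"
  shows "commutator A x y \<in> lin_span B"
proof -
  have *: "commutator A x q \<in> lin_span B" if "q \<in> Q" for q
  proof -
    have "q \<in> carrier A" using that Q by auto
    with x show ?thesis
      by (induction) (use PQ that P in \<open>auto simp: commutator_add commutator_smult lin_span_closed intro: lin_span.intros\<close>)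
  qed
  have "x \<in> carrier A" using x P by (rule lin_span_closed)
  with y show ?thesis
    by (induction) (use * Q in \<open>auto simp: commutator_add commutator_smult lin_span_closed intro: lin_span.intros\<close>)
qed

end

section \<open>The Lie nilpotent algebra\<close>

definition code :: "nat set \<Rightarrow> nat set \<Rightarrow> nat" where
  "code S I = prod_encode (set_encode S, set_encode I)"

definition code_S :: "nat \<Rightarrow> nat set" where
  "code_S n = set_decode (fst (prod_decode n))"

definition code_I :: "nat \<Rightarrow> nat set" where
  "code_I n = set_decode (snd (prod_decode n))"

lemma code_inverse [simp]:
  "finite S \<Longrightarrow> code_S (code S I) = S" "finite I \<Longrightarrow> code_I (code S I) = I"
  "code (code_S n) (code_I n) = n"
  by (simp_all add: code_def code_S_def code_I_def)

lemma finite_code_S [simp]: "finite (code_S n)" and finite_code_I [simp]: "finite (code_I n)"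
  by (simp_all add: code_S_def code_I_def)

definition even_subsets :: "nat \<Rightarrow> nat set set" where
  "even_subsets m = {I. I \<subseteq> {..<m} \<and> even (card I)}"

lemma finite_even_subsets [simp]: "finite (even_subsets m)"
  by (rule finite_subset[of _ "Pow {..<m}"]) (auto simp: even_subsets_def)

text \<open>Even if r has infinitely many terms, only its monomials inside K contribute at
  K.\<close>

lemma ecoeff_mult_expand:
  assumes "K \<subseteq> {..<m}"
  shows "ecoeff (r * t) K = (\<Sum>I\<in>even_subsets m. ecoeff r I * ecoeff (emon I * t) K)"
proof -
  have fin: "finite K" using assms finite_subset by blast
  have "ecoeff (r * t) K = (\<Sum>I\<in>even_subsets m. if I \<subseteq> K then order_sign I (K - I) * ecoeff r I * ecoeff t (K - I) else 0)"
    unfolding ecoeff_mult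
  proof (rule sum.mono_neutral_cong)
    fix I assume "I \<in> even_subsets m - Pow K"
    then show "(if I \<subseteq> K then order_sign I (K - I) * ecoeff r I * ecoeff t (K - I) else 0) = 0" by auto
  next
    fix I assume "I \<in> Pow K - even_subsets m"
    then have "odd (card I)" using assms by (auto simp: even_subsets_def)
    then show "order_sign I (K - I) * ecoeff r I * ecoeff t (K - I) = 0"
      using ecoeff_nonzeroD(2)[of r I] by auto
  qed (use fin in auto)
  also have "\<dots> = (\<Sum>I\<in>even_subsets m. ecoeff r I * ecoeff (emon I * t) K)"
  proof (rule sum.cong)
    fix I assume "I \<in> even_subsets m"
    then have "finite I" "even (card I)" by (auto simp: even_subsets_def intro: finite_subset[of I "{..<m}"])
    then show "(if I \<subseteq> K then order_sign I (K - I) * ecoeff r I * ecoeff t (K - I) else 0)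
        = ecoeff r I * ecoeff (emon I * t) K"
      using fin by (simp add: ecoeff_emon_mult)
  qed simp
  finally show ?thesis .
qed

lemma ecoeff_mult_mult_expand:
  assumes "K \<subseteq> {..<m}"
  shows "ecoeff (r * r' * t) K
    = (\<Sum>I\<in>even_subsets m. \<Sum>I'\<in>even_subsets m. ecoeff r I * ecoeff r' I' * ecoeff (emon I * emon I' * t) K)"
proof -
  have "ecoeff (r * r' * t) K = (\<Sum>I\<in>even_subsets m. ecoeff r I * ecoeff (r' * (emon I * t)) K)"
    using ecoeff_mult_expand[OF assms, of r "r' * t"] by (simp only: mult.assoc mult.left_commute[of r'])
  also have "\<dots> = (\<Sum>I\<in>even_subsets m. \<Sum>I'\<in>even_subsets m. ecoeff r I * ecoeff r' I' * ecoeff (emon I * emon I' * t) K)"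
  proof (rule sum.cong)
    fix I
    have "ecoeff (r' * (emon I * t)) K = (\<Sum>I'\<in>even_subsets m. ecoeff r' I' * ecoeff (emon I' * (emon I * t)) K)"
      by (rule ecoeff_mult_expand[OF assms])
    also have "\<dots> = (\<Sum>I'\<in>even_subsets m. ecoeff r' I' * ecoeff (emon I * emon I' * t) K)"
      by (simp only: mult.assoc mult.commute mult.left_commute)
    finally show "ecoeff r I * ecoeff (r' * (emon I * t)) K
        = (\<Sum>I'\<in>even_subsets m. ecoeff r I * ecoeff r' I' * ecoeff (emon I * emon I' * t) K)"
      by (simp add: sum_distrib_left mult.assoc)
  qed simp
  finally show ?thesis .
qed

text \<open>Names of the basis elements \<open>emon I\<close> e_S with S below N and I among the c
  \<open>eta\<close> and the first N \<open>theta\<close> generators. Numbers are used because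
  vectors of \<open>alg\<close> are indexed by \<open>nat\<close>.\<close>

definition codes :: "nat \<Rightarrow> nat \<Rightarrow> nat set" where
  "codes c N = {n. code_S n \<subseteq> {..<N} \<and> code_I n \<in> even_subsets (c + N)}"

lemma codes_eq: "codes c N = (\<lambda>(S, I). code S I) ` (Pow {..<N} \<times> even_subsets (c + N))"
proof
  show "codes c N \<subseteq> (\<lambda>(S, I). code S I) ` (Pow {..<N} \<times> even_subsets (c + N))"
  proof
    fix n assume "n \<in> codes c N"
    then show "n \<in> (\<lambda>(S, I). code S I) ` (Pow {..<N} \<times> even_subsets (c + N))"
      by (intro image_eqI[of _ _ "(code_S n, code_I n)"]) (auto simp: codes_def)
  qed
next
  have "finite S" if "S \<subseteq> {..<N}" for S using that finite_subset by blast
  moreover have "finite I" if "I \<in> even_subsets (c + N)" for I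
    using that finite_subset unfolding even_subsets_def by blast
  ultimately show "(\<lambda>(S, I). code S I) ` (Pow {..<N} \<times> even_subsets (c + N)) \<subseteq> codes c N"
    by (auto simp: codes_def)
qed

lemma finite_codes [simp]: "finite (codes c N)"
  unfolding codes_eq by simp

text \<open>Truncation to the finite basis. The omitted basis elements have S or I outside the
  allowed range, and multiplication only enlarges these sets, so omitting them amounts to passing to
  a quotient.\<close>

definition coords :: "nat \<Rightarrow> nat \<Rightarrow> even_ext \<times> nat set \<Rightarrow> nat \<Rightarrow> int" where
  "coords c N p n = (if n \<in> codes c N \<and> code_S n = snd p then ecoeff (fst p) (code_I n) else 0)"

definition basis_pair :: "nat \<Rightarrow> even_ext \<times> nat set" where
  "basis_pair n = (emon (code_I n), code_S n)"

definition structure_const :: "nat \<Rightarrow> nat \<Rightarrow> nat \<Rightarrow> nat \<Rightarrow> nat \<Rightarrow> int" where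
  "structure_const c N i j = coords c N (tw.pmult c (basis_pair i) (basis_pair j))"

lemma unit_vec_eq_coords:
  assumes "i \<in> codes c N"
  shows "unit_vec i = coords c N (basis_pair i)"
proof
  fix n
  have "n = i \<longleftrightarrow> code_S n = code_S i \<and> code_I n = code_I i"
    using code_inverse(3) by metis
  then show "unit_vec i n = coords c N (basis_pair i) n"
    using assms by (auto simp: unit_vec_def coords_def basis_pair_def ecoeff_emon codes_def even_subsets_def)
qed

lemma coords_diff: "coords c N (r, S) n - coords c N (r', S) n = coords c N (r - r', S) n"
  by (simp add: coords_def)

lemma sum_coords:
  assumes "S \<subseteq> {..<N}"
  shows "(\<Sum>n\<in>codes c N. coords c N (r, S) n * h n) = (\<Sum>I\<in>even_subsets (c + N). ecoeff r I * h (code S I))"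
proof -
  have fin: "finite S" using assms finite_subset by blast
  have finI: "finite I" if "I \<in> even_subsets (c + N)" for I
    using that finite_subset unfolding even_subsets_def by blast
  have "(\<Sum>n\<in>codes c N. coords c N (r, S) n * h n) = (\<Sum>n\<in>code S ` even_subsets (c + N). coords c N (r, S) n * h n)"
  proof (rule sum.mono_neutral_right)
    show "code S ` even_subsets (c + N) \<subseteq> codes c N"
      unfolding codes_eq using assms by auto
    show "\<forall>n\<in>codes c N - code S ` even_subsets (c + N). coords c N (r, S) n * h n = 0"
    proof
      fix n assume n: "n \<in> codes c N - code S ` even_subsets (c + N)"
      have "n \<in> code (code_S n) ` even_subsets (c + N)"
        using n by (intro image_eqI[of _ _ "code_I n"]) (simp_all add: codes_def)
      then have "code_S n \<noteq> S" using n by blast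
      then show "coords c N (r, S) n * h n = 0" by (simp add: coords_def)
    qed
  qed simp
  also have "\<dots> = (\<Sum>I\<in>even_subsets (c + N). coords c N (r, S) (code S I) * h (code S I))"
    by (subst sum.reindex) (auto intro!: inj_on_inverseI[of _ code_I] simp: finI)
  also have "\<dots> = (\<Sum>I\<in>even_subsets (c + N). ecoeff r I * h (code S I))"
    using assms fin finI by (intro sum.cong) (auto simp: coords_def codes_def)
  finally show ?thesis .
qed

text \<open>Coefficients of a product within the allowed range depend only on those of r and r' in
  that range. This reduces the claim to monomials, where it is the definition of
  \<open>structure_const\<close>.\<close>

lemma conv_coords:
  assumes "finite (snd p)" "finite (snd q)"
  shows "conv (codes c N) (structure_const c N) (coords c N p) (coords c N q) = coords c N (tw.pmult c p q)"
proof
  fix u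
  obtain r S where [simp]: "p = (r, S)" by (cases p)
  obtain r' T where [simp]: "q = (r', T)" by (cases q)
  have fin: "finite S" "finite T" using assms by simp_all
  show "conv (codes c N) (structure_const c N) (coords c N p) (coords c N q) u = coords c N (tw.pmult c p q) u"
  proof (cases "u \<in> codes c N \<and> S \<subseteq> {..<N} \<and> T \<subseteq> {..<N}")
    case True
    then have K: "code_I u \<subseteq> {..<c + N}" by (auto simp: codes_def even_subsets_def)
    have finI: "finite I" if "I \<in> even_subsets (c + N)" for I
      using that finite_subset unfolding even_subsets_def by blast
    have "conv (codes c N) (structure_const c N) (coords c N p) (coords c N q) u
      = (\<Sum>i\<in>codes c N. \<Sum>j\<in>codes c N. structure_const c N i j u * (coords c N p i * coords c N q j))"
      using True by (simp add: conv_def sum.cartesian_product)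
    also have "\<dots> = (\<Sum>i\<in>codes c N. coords c N p i * (\<Sum>j\<in>codes c N. coords c N q j * structure_const c N i j u))"
      by (simp add: sum_distrib_left ac_simps)
    also have "\<dots> = (\<Sum>I\<in>even_subsets (c + N). \<Sum>I'\<in>even_subsets (c + N).
        ecoeff r I * ecoeff r' I' * structure_const c N (code S I) (code T I') u)"
      using True by (simp add: sum_coords) (simp add: sum_distrib_left mult.assoc)
    also have "\<dots> = (\<Sum>I\<in>even_subsets (c + N). \<Sum>I'\<in>even_subsets (c + N).
        ecoeff r I * ecoeff r' I' * coords c N (tw.pmult c (emon I, S) (emon I', T)) u)"
      using fin finI by (intro sum.cong refl) (simp add: structure_const_def basis_pair_def)
    also have "\<dots> = coords c N (tw.pmult c p q) u"
    proof (cases "S \<inter> T = {} \<and> code_S u = S \<union> T")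
      case disj: True
      then show ?thesis
        using True ecoeff_mult_mult_expand[OF K, of r r' "tw.sigma c S T"] by (simp add: coords_def)
    next
      case False
      then have "coords c N (tw.pmult c (x, S) (y, T)) u = 0" for x y
        by (cases "S \<inter> T = {}") (simp_all add: coords_def)
      then show ?thesis by simp
    qed
    finally show ?thesis .
  next
    case False
    have "coords c N (tw.pmult c p q) u = 0"
      using False by (auto simp: coords_def codes_def)
    moreover have "coords c N p = (\<lambda>_. 0) \<or> coords c N q = (\<lambda>_. 0) \<or> u \<notin> codes c N"
      using False by (auto simp: coords_def codes_def fun_eq_iff)
    ultimately show ?thesis by (auto simp: conv_def)
  qed
qed


lemma coords_commutator:
  assumes "finite (snd p)" "finite (snd q)"
  shows "coords c N (tw.pmult c p q) n - coords c N (tw.pmult c q p) n = coords c N (tw.pcomm c p q) n"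
proof -
  obtain r S where [simp]: "p = (r, S)" by (cases p)
  obtain r' T where [simp]: "q = (r', T)" by (cases q)
  have qp: "tw.pmult c q p = (if S \<inter> T = {} then r * r' * tw.sigma c T S else 0, S \<union> T)"
    by (simp add: Un_commute Int_commute mult.commute)
  show ?thesis
    unfolding qp by (simp add: coords_diff right_diff_distrib)
qed

section \<open>The algebra over F: nilpotency and a nonzero product\<close>

locale twisted_algebra = field F for F (structure) +
  fixes c N :: nat
begin

sublocale int_base_change F "codes c N" "structure_const c N" "coords c N (1, {})"
  by unfold_locales simp

lemma unital_assoc_algebra: "unital_assoc_algebra F alg"
proof (rule unital_assoc_algebra_alg)
  have fin: "finite (snd (basis_pair i))" for i by (simp add: basis_pair_def)
  fix i j k assume "i \<in> codes c N" "j \<in> codes c N" "k \<in> codes c N"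
  then show "conv (codes c N) (structure_const c N) (conv (codes c N) (structure_const c N) (unit_vec i) (unit_vec j)) (unit_vec k)
      = conv (codes c N) (structure_const c N) (unit_vec i) (conv (codes c N) (structure_const c N) (unit_vec j) (unit_vec k))"
    by (simp add: unit_vec_eq_coords conv_coords fin tw.finite_pmult tw.pmult_assoc)
next
  fix i assume "i \<in> codes c N"
  moreover have "finite (snd (basis_pair i))" by (simp add: basis_pair_def)
  ultimately show "conv (codes c N) (structure_const c N) (coords c N (1, {})) (unit_vec i) = unit_vec i"
    "conv (codes c N) (structure_const c N) (unit_vec i) (coords c N (1, {})) = unit_vec i"
    by (simp_all add: unit_vec_eq_coords conv_coords tw.pmult_one)
qed

sublocale A: unital_assoc_algebra F alg
  by (rule unital_assoc_algebra)

definition elt :: "even_ext \<times> nat set \<Rightarrow> nat \<Rightarrow> 'a" where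
  "elt p = ext (coords c N p)"

lemma elt_closed [simp]: "elt p \<in> carrier alg"
  by (simp add: elt_def ext_closed)

lemma elt_mult: "finite (snd p) \<Longrightarrow> finite (snd q) \<Longrightarrow> elt p \<otimes>\<^bsub>alg\<^esub> elt q = elt (tw.pmult c p q)"
  by (simp add: elt_def ext_mult conv_coords)

lemma elt_commutator:
  assumes "finite (snd p)" "finite (snd q)"
  shows "commutator alg (elt p) (elt q) = elt (tw.pcomm c p q)"
proof -
  have "commutator alg (elt p) (elt q)
      = ext (\<lambda>n. coords c N (tw.pmult c p q) n - coords c N (tw.pmult c q p) n)"
    unfolding commutator_def elt_mult[OF assms] elt_mult[OF assms(2,1)] by (simp add: elt_def ext_minus)
  then show ?thesis
    by (simp add: elt_def coords_commutator[OF assms])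
qed

lemma elt_0: "elt (0, S) = \<zero>\<^bsub>alg\<^esub>"
  by (simp add: elt_def ext_def coords_def fun_eq_iff alg_simps)

lemma lin_span_elt: "carrier alg \<subseteq> A.lin_span {elt (r, S) |r S. finite S}"
proof -
  have "ext (unit_vec i) = elt (basis_pair i)" if "i \<in> codes c N" for i
    using that by (simp add: elt_def unit_vec_eq_coords)
  then have "ext (unit_vec i) \<in> {elt (r, S) |r S. finite S}" if "i \<in> codes c N" for i
    using that finite_code_S unfolding basis_pair_def by blast
  then have "(\<lambda>i. ext (unit_vec i)) ` codes c N \<subseteq> {elt (r, S) |r S. finite S}"
    by blast
  moreover have "A.lin_span B \<subseteq> A.lin_span C" if "B \<subseteq> C" for B C
  proof
    fix x assume "x \<in> A.lin_span B"
    then show "x \<in> A.lin_span C"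
      by induction (use that in \<open>auto intro: A.lin_span.intros\<close>)
  qed
  ultimately show ?thesis using alg_span by blast
qed

text \<open>The square of z is mapped to 1, whatever the characteristic.\<close>

lemma emb_nonzero:
  assumes "\<bar>z\<bar> = 1"
  shows "emb z \<noteq> \<zero>"
proof
  assume "emb z = \<zero>"
  then have "emb (z * z) = \<zero>" by (simp add: emb_mult)
  moreover have "z * z = 1" using assms by (auto simp: abs_if split: if_splits)
  ultimately show False by simp
qed

text \<open>Contains the values of all left-normed commutators of length \<open>l \<ge> 2\<close> in the spanning elements; the
  numerical arguments of \<open>alternating\<close> bound from below the degrees in the \<open>eta\<close> generators.\<close>

definition layer :: "nat \<Rightarrow> (nat \<Rightarrow> 'a) set" where
  "layer l = {elt (r, S) |r S. finite S \<and> tw.alternating c (2 * ((l - 1) div 2)) (2 * (l div 2)) r S}"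

text \<open>Multilinearity reduces the entries to spanning elements. There the bounds start with 0
  and 2 for length 2 and are updated with each further entry.\<close>

lemma left_normed_commutator_layer:
  assumes "2 \<le> length us" "set us \<subseteq> carrier alg"
  shows "left_normed_commutator alg us \<in> A.lin_span (layer (length us))"
proof -
  let ?E = "{elt (r, S) |r S. finite S}"
  have E: "?E \<subseteq> carrier alg" by auto
  have layer: "layer l \<subseteq> carrier alg" for l by (auto simp: layer_def)
  have "left_normed_commutator alg us \<in> A.lin_span (layer (length us))"
    if "us = a # b # xs" "set us \<subseteq> carrier alg" for us a b xs
    using that
  proof (induction xs arbitrary: us rule: rev_induct)
    case Nil
    have step: "commutator alg p q \<in> A.lin_span (layer 2)" if pq_in: "p \<in> ?E" "q \<in> ?E" for p q
    proof -
      obtain r S r' T where pq: "p = elt (r, S)" "q = elt (r', T)" "finite S" "finite T"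
        using pq_in by blast
      obtain r'' U where U: "tw.pcomm c (r, S) (r', T) = (r'', U)" by (rule prod.exhaust)
      then have "finite U" using pq(3,4) by auto
      then have "elt (r'', U) \<in> layer 2"
        using tw.alternating_pcomm_init[OF pq(3,4) U] by (auto simp: layer_def)
      then show ?thesis
        using pq U by (simp add: elt_commutator A.lin_span.base)
    qed
    have "a \<in> carrier alg" "b \<in> carrier alg" using Nil by simp_all
    then have "commutator alg a b \<in> A.lin_span (layer 2)"
      by (intro A.commutator_lin_span[OF E E step] subsetD[OF lin_span_elt])
    then show ?case using Nil by (simp add: left_normed_commutator_def numeral_2_eq_2)
  next
    case (snoc x xs)
    define l where "l = length xs + 2"
    have IH: "left_normed_commutator alg (a # b # xs) \<in> A.lin_span (layer l)"
      using snoc.IH[of "a # b # xs"] snoc.prems by (simp add: l_def)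
    have step: "commutator alg p q \<in> A.lin_span (layer (Suc l))" if pq_in: "p \<in> layer l" "q \<in> ?E" for p q
    proof -
      obtain r S r' T where pq: "p = elt (r, S)" "q = elt (r', T)" "finite S" "finite T"
        and alt: "tw.alternating c (2 * ((l - 1) div 2)) (2 * (l div 2)) r S"
        using pq_in unfolding layer_def by blast
      obtain r'' U where U: "tw.pcomm c (r, S) (r', T) = (r'', U)" by (rule prod.exhaust)
      then have fin: "finite U" using pq(3,4) by auto
      \<comment> \<open>The first bound for length l + 1 is the second one for length l; the second
        bound is the old first one raised by 2.\<close>
      have "2 * ((l - 1) div 2) + 2 = 2 * (Suc l div 2)" by (simp add: l_def)
      then have "elt (r'', U) \<in> layer (Suc l)"
        using tw.alternating_pcomm[OF pq(3,4) alt U] fin unfolding layer_def by auto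
      then show ?thesis
        using pq U by (simp add: elt_commutator A.lin_span.base)
    qed
    have "x \<in> carrier alg" using snoc.prems by simp
    then have "commutator alg (left_normed_commutator alg (a # b # xs)) x \<in> A.lin_span (layer (Suc l))"
      using IH by (intro A.commutator_lin_span[OF layer E step] subsetD[OF lin_span_elt])
    then show ?case
      using left_normed_commutator_snoc[of "a # b # xs" alg x] snoc.prems by (simp add: l_def)
  qed
  moreover obtain a b xs where "us = a # b # xs"
    using assms(1) by (auto simp: numeral_2_eq_2 Suc_le_length_iff)
  ultimately show ?thesis using assms(2) by blast
qed

lemma left_normed_commutator_eq_zero:
  assumes "even c" "length us = c + 3" "set us \<subseteq> carrier alg"
  shows "left_normed_commutator alg us = \<zero>\<^bsub>alg\<^esub>"
proof -
  \<comment> \<open>As c + 3 is odd, both bounds are c + 2, more than the number c of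
    \<open>eta\<close> generators.\<close>
  have "c < 2 * ((length us - 1) div 2)" "c < 2 * (length us div 2)"
    using assms(1) unfolding assms(2) by presburger+
  then have "r = 0" if "tw.alternating c (2 * ((length us - 1) div 2)) (2 * (length us div 2)) r S" for r S
    using tw.alternating_eq_0[OF that] by simp
  then have "layer (length us) \<subseteq> {\<zero>\<^bsub>alg\<^esub>}"
    unfolding layer_def using elt_0 by blast
  moreover have "x = \<zero>\<^bsub>alg\<^esub>" if "x \<in> A.lin_span B" "B \<subseteq> {\<zero>\<^bsub>alg\<^esub>}" for x B
    using that by (induction) auto
  moreover have "left_normed_commutator alg us \<in> A.lin_span (layer (length us))"
    using assms by (intro left_normed_commutator_layer) auto
  ultimately show ?thesis by blast
qed

lemma left_normed_commutator_elt:
  assumes "\<forall>p\<in>set (q # ps). finite (snd p)"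
  shows "left_normed_commutator alg (map elt (q # ps)) = elt (foldl (tw.pcomm c) q ps) \<and>
    finite (snd (foldl (tw.pcomm c) q ps))"
  using assms
proof (induction ps rule: rev_induct)
  case Nil
  then show ?case by (simp add: left_normed_commutator_def)
next
  case (snoc p ps)
  then show ?case
    using left_normed_commutator_snoc[of "map elt (q # ps)" alg "elt p"]
    by (simp add: elt_commutator tw.finite_pcomm)
qed

text \<open>The commutators share out the indices below c, taking 2k and 2l of them, and so use each
  \<open>eta\<close> generator exactly once. The outer entries c, ..., c + 3 carry only
  \<open>theta\<close> generators and account for N = c + 4.\<close>

lemma left_normed_commutators_nonzero:
  assumes "c = 2 * k + 2 * l" "N = c + 4"
  defines "gens \<equiv> \<lambda>a b p q. map (\<lambda>i. elt (1, {i})) (a # [p..<p + 2 * q] @ [b])"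
  shows "left_normed_commutator alg (gens c (c + 1) 0 k) \<otimes>\<^bsub>alg\<^esub>
    left_normed_commutator alg (gens (c + 2) (c + 3) (2 * k) l) \<noteq> \<zero>\<^bsub>alg\<^esub>"
proof -
  define gen_set where "gen_set S = (+) c ` S \<union> (S \<inter> {..<c})" for S :: "nat set"
  have comm: "\<exists>r. left_normed_commutator alg (gens a b p q) = elt (r, S) \<and> unit_mon (gen_set S) r"
    if S: "c \<le> a" "c \<le> b" "a \<noteq> b" "p + 2 * q \<le> c" "S = {a, b} \<union> {p..<p + 2 * q}" for a b p q S
  proof -
    obtain r where r: "foldl (tw.pcomm c) (1, {a}) (map (\<lambda>i. (1, {i})) ([p..<p + 2 * q] @ [b])) = (r, S)"
      "unit_mon (gen_set S) r"
      using unit_mon_foldl_pcomm_final[OF S(1-4)] S(5) unfolding gen_set_def by blast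
    have "gens a b p q = map elt ((1, {a}) # map (\<lambda>i. (1, {i})) ([p..<p + 2 * q] @ [b]))"
      by (simp add: gens_def)
    then have "left_normed_commutator alg (gens a b p q) = elt (r, S)"
      using left_normed_commutator_elt[of "(1, {a})" "map (\<lambda>i. (1, {i})) ([p..<p + 2 * q] @ [b])"] r(1)
      by (simp del: map_append)
    then show ?thesis using r(2) by blast
  qed
  \<comment> \<open>Evenness matters because \<open>emon\<close> is 0 on sets of odd size. There are
    2 + 2q \<open>theta\<close> and 2q \<open>eta\<close> generators.\<close>
  have card: "even (card (gen_set S))" if "c \<le> a" "c \<le> b" "a \<noteq> b" "p + 2 * q \<le> c" "S = {a, b} \<union> {p..<p + 2 * q}"
    for a b p q S
  proof -
    have "card (gen_set S) = card ((+) c ` S) + card (S \<inter> {..<c})"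
      unfolding gen_set_def using that(5) by (intro card_Un_disjoint) auto
    also have "card ((+) c ` S) = card S" by (simp add: card_image)
    also have "card S = 2 + 2 * q"
      using that by (simp add: card_Un_disjoint)
    also have "S \<inter> {..<c} = {p..<p + 2 * q}" using that by auto
    finally show ?thesis by simp
  qed
  define S where "S = {c, c + 1} \<union> {0..<0 + 2 * k}"
  define T where "T = {c + 2, c + 3} \<union> {2 * k..<2 * k + 2 * l}"
  obtain r where r: "left_normed_commutator alg (gens c (c + 1) 0 k) = elt (r, S)" "unit_mon (gen_set S) r"
    using comm[OF _ _ _ _ S_def] assms(1) by auto
  obtain r' where r': "left_normed_commutator alg (gens (c + 2) (c + 3) (2 * k) l) = elt (r', T)"
    "unit_mon (gen_set T) r'"
    using comm[OF _ _ _ _ T_def] assms(1) by auto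
  have disj: "S \<inter> T = {}" using assms by (auto simp: S_def T_def)
  have finST: "finite S" "finite T" by (simp_all add: S_def T_def)
  define K where "K = gen_set S \<union> gen_set T"
  have fin: "finite (gen_set S)" "finite (gen_set T)" using finST by (auto simp: gen_set_def)
  have disj': "gen_set S \<inter> gen_set T = {}" using disj by (auto simp: gen_set_def)
  have even: "even (card (gen_set S))" "even (card (gen_set T))"
    using card[OF _ _ _ _ S_def] card[OF _ _ _ _ T_def] assms(1) by simp_all
  define t where "t = r * r' * tw.sigma c S T"
  have "unit_mon K t"
    unfolding K_def t_def using r r' tw.ecoeff_sigma_empty disj' fin even by (intro unit_mon_mult)
  moreover have finK: "finite K" "even (card K)"
    using fin even disj' by (auto simp: K_def card_Un_disjoint)
  ultimately have emb: "emb (ecoeff t K) \<noteq> \<zero>"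
    by (intro emb_nonzero unit_mon_ecoeff)
  have ST: "S \<union> T \<subseteq> {..<N}" using assms by (auto simp: S_def T_def)
  then have "K \<subseteq> {..<c + N}" by (auto simp: K_def gen_set_def)
  then have "code (S \<union> T) K \<in> codes c N"
    using finK finST ST by (simp add: codes_def even_subsets_def)
  \<comment> \<open>The product is distinguished from 0 by its coordinate at the monomial K, the
    image of 1 or -1 in F.\<close>
  then have "elt (t, S \<union> T) (code (S \<union> T) K) = emb (ecoeff t K)"
    using finK finST by (simp add: elt_def ext_def coords_def)
  moreover have "elt (r, S) \<otimes>\<^bsub>alg\<^esub> elt (r', T) = elt (t, S \<union> T)"
    using finST disj by (simp add: elt_mult t_def)
  moreover have "\<zero>\<^bsub>alg\<^esub> (code (S \<union> T) K) = \<zero>"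
    by (simp add: alg_simps)
  ultimately show ?thesis
    using emb unfolding r(1) r'(1) by metis
qed

end

theorem theorem1p4:
  fixes F :: "('f, 'r) ring_scheme" and m n m' n' :: nat
  assumes "field F"
    and "m' \<ge> 1" and "n' \<ge> 1"
    and "m = 2 * m'" and "n = 2 * n'"
  shows "\<exists>A :: ('f, nat \<Rightarrow> 'f) module.
    unital_assoc_algebra F A \<and>
    ((\<forall>us. set us \<subseteq> carrier A \<and> length us = m + n - 1
        \<longrightarrow> left_normed_commutator A us = \<zero>\<^bsub>A\<^esub>)
      \<and> lie_nilpotent_class_at_most A (m + n - 2)) \<and>
    (\<exists>vs ws. set vs \<subseteq> carrier A \<and> length vs = m \<and> set ws \<subseteq> carrier A \<and> length ws = n \<and>
        left_normed_commutator A vs \<otimes>\<^bsub>A\<^esub> left_normed_commutator A ws \<noteq> \<zero>\<^bsub>A\<^esub>)"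
proof -
  \<comment> \<open>This is m + n - 4: the commutators of lengths m and n have two outer entries
    each, and their inner entries are the indices below c.\<close>
  define c where "c = 2 * (m' - 1) + 2 * (n' - 1)"
  interpret twisted_algebra F c "c + 4"
    by (rule twisted_algebra.intro) fact
  have len: "m + n - 1 = c + 3" "m + n - 2 + 1 = c + 3" and "even c"
    using assms(2-5) by (simp_all add: c_def)
  have nil: "left_normed_commutator alg us = \<zero>\<^bsub>alg\<^esub>"
    if "set us \<subseteq> carrier alg" "length us = c + 3" for us
    using left_normed_commutator_eq_zero \<open>even c\<close> that by blast
  let ?gens = "\<lambda>a b p q. map (\<lambda>i. elt (1, {i})) (a # [p..<p + 2 * q] @ [b])"
  let ?vs = "?gens c (c + 1) 0 (m' - 1)" and ?ws = "?gens (c + 2) (c + 3) (2 * (m' - 1)) (n' - 1)"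
  have "left_normed_commutator alg ?vs \<otimes>\<^bsub>alg\<^esub> left_normed_commutator alg ?ws \<noteq> \<zero>\<^bsub>alg\<^esub>"
    by (rule left_normed_commutators_nonzero) (simp_all add: c_def)
  moreover have "set ?vs \<subseteq> carrier alg" "set ?ws \<subseteq> carrier alg" by auto
  moreover have "length ?vs = m" "length ?ws = n" using assms(2-5) by simp_all
  ultimately have "\<exists>vs ws. set vs \<subseteq> carrier alg \<and> length vs = m \<and> set ws \<subseteq> carrier alg \<and> length ws = n \<and>
        left_normed_commutator alg vs \<otimes>\<^bsub>alg\<^esub> left_normed_commutator alg ws \<noteq> \<zero>\<^bsub>alg\<^esub>"
    by blast
  then show ?thesis
    using unital_assoc_algebra nil unfolding lie_nilpotent_class_at_most_def len by blast
qed

end
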